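(* Let $(\tau_j,B_j,q_j)$ be a full-tail saturated Hodge family for $u$. Then for every sufficiently large $J$, with $t_0=\tau_{J+1}$, $$\int_{t_0}^{T_*}(\mathcal P_J(t))_+\,dt=\infty .$$
   Context: Setting. $\Omega=\mathbb T^3$ is the standard flat three-dimensional torus, $\nu>0$, $t_b<T_*<\infty$, $\mathbb P$ is the Leray projector. $u$ is a real-valued divergence-free vector field, smooth on $[t_b,T_* )\times\Omega$, solving $\partial_tu+\mathbb P[(u\cdot\nabla)u]=\nu\Delta u$, $\nabla\cdot u=0$, with $\sup_{t_b\le t<T_*}\lVert u(t)\rVert_2<\infty$ and $\int_{t_b}^{T_*}\lVert\nabla u(t)\rVert_2^2\,dt<\infty$. $L^2_\sigma(\Omega)$ is the real Hilbert space of periodic divergence-free $L^2$ vector fields (including constants). For $t_b\le s\le t<T_*$, $U(t,s)$ is the propagator on $L^2_\sigma(\Omega)$ of $\partial_th+\mathbb P[(u\cdot\nabla)h]=\nu\Delta h$, $h(s)=h_s$; $U(t,s)^*$ is its adjoint. For an open ball $B\Subset\Omega$, $\mathcal H(B)$ is the $L^2(\Omega)$-closure of the smooth divergence-free fields compactly supported in $B$. Full-tail saturated Hodge family: a sequence $(\tau_j,B_j,q_j)$ with $\tau_j$ strictly increasing, $\tau_j\uparrow T_*$; balls with $B_{j+1}\Subset B_j$, $\operatorname{diam}B_j\to0$; orthonormal $q_j\in\mathcal H(B_j)\cap\mathcal H(B_{j+1})^\perp$ with $q_j=0$ a.e. on $\Omega\setminus B_j$ and $q_j$ a harmonic gradient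 in $B_{j+1}$ (that is, $q_j=\nabla h$ there with $h$ harmonic); such that as $J\to\infty$ the suprema over $k>j\ge J$ of each of $\lVert U(\tau_k,\tau_j)q_j-q_k\rVert_2$, $\lVert U(\tau_k,\tau_j)^*q_k-q_j\rVert_2$, $2\nu\int_{\tau_j}^{\tau_k}\lVert\nabla U(t,\tau_j)q_j\rVert_2^2dt$, $2\nu\int_{\tau_j}^{\tau_k}\lVert\nabla U(\tau_k,t)^*q_k\rVert_2^2dt$ tend to $0$. Production. For fixed $J$, $H^J(t):=U(t,\tau_J)q_J$ and $\mathcal P_J(t):=\langle\Delta H^J(t),\mathbb P[(u(t)\cdot\nabla)H^J(t)]\rangle$ ($L^2$ inner product), for $\tau_J<t<T_*$. $(x)_+=\max\{x,0\}$. *)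

theory Defs
  imports "HOL-Analysis.Analysis"
begin

section \<open>Smooth functions and classical differential operators\<close>

text \<open>
  Derivatives are taken within \<open>S\<close>, so that for sets such as \<open>{t\<^sub>b..<T} \<times> UNIV\<close> smoothness
  includes the one-sided time derivatives at the initial time. The definition is meant for convex
  sets with non-empty interior and for open sets, where derivatives within \<open>S\<close> are unique.
\<close>

primrec Ck_on :: "nat \<Rightarrow> 'a::real_normed_vector set \<Rightarrow> ('a \<Rightarrow> 'b::real_normed_vector) \<Rightarrow> bool" where
  "Ck_on 0 S f \<longleftrightarrow> continuous_on S f"
| "Ck_on (Suc n) S f \<longleftrightarrow>
     f differentiable_on S \<and> (\<forall>v. Ck_on n S (\<lambda>x. frechet_derivative f (at x within S) v))"

definition smooth_on :: "'a::real_normed_vector set \<Rightarrow> ('a \<Rightarrow> 'b::real_normed_vector) \<Rightarrow> bool" where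
  "smooth_on S f \<longleftrightarrow> (\<forall>n. Ck_on n S f)"

type_synonym vfield = "real^3 \<Rightarrow> real^3"

definition divergence :: "vfield \<Rightarrow> real^3 \<Rightarrow> real" where
  "divergence f x = (\<Sum>b\<in>Basis. frechet_derivative f (at x) b \<bullet> b)"

definition laplacian :: "(real^3 \<Rightarrow> 'b::real_normed_vector) \<Rightarrow> real^3 \<Rightarrow> 'b" where
  "laplacian f x =
     (\<Sum>b\<in>Basis. frechet_derivative (\<lambda>y. frechet_derivative f (at y) b) (at x) b)"

text \<open>\<open>advect u h\<close> is \<open>(u \<cdot> \<nabla>)h\<close>.\<close>

definition advect :: "vfield \<Rightarrow> vfield \<Rightarrow> vfield" where
  "advect u h x = frechet_derivative h (at x) (u x)"

definition harmonic_on :: "(real^3) set \<Rightarrow> (real^3 \<Rightarrow> real) \<Rightarrow> bool" where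
  "harmonic_on S h \<longleftrightarrow> Ck_on 2 S h \<and> (\<forall>x\<in>S. laplacian h x = 0)"


section \<open>The flat torus\<close>

text \<open>
  The torus is \<open>\<real>\<^sup>3 / \<int>\<^sup>3\<close>: functions on it are \<open>\<int>\<^sup>3\<close>-periodic functions on \<open>\<real>\<^sup>3\<close>, subsets of it
  are \<open>\<int>\<^sup>3\<close>-invariant subsets of \<open>\<real>\<^sup>3\<close>, and integrals are taken over the unit cube (which is a
  fundamental domain up to a null set).
\<close>

definition lattice :: "(real^3) set" where
  "lattice = {z. \<forall>i. z $ i \<in> \<int>}"

definition periodic :: "(real^3 \<Rightarrow> 'b) \<Rightarrow> bool" where
  "periodic f \<longleftrightarrow> (\<forall>x. \<forall>z\<in>lattice. f (x + z) = f x)"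

definition torus :: "(real^3) measure" where
  "torus = restrict_space lborel (cbox 0 1)"

definition torus_dist :: "real^3 \<Rightarrow> real^3 \<Rightarrow> real" where
  "torus_dist x y = infdist (x - y) lattice"

definition torus_ball :: "real^3 \<Rightarrow> real \<Rightarrow> (real^3) set" where
  "torus_ball c r = {x. torus_dist c x < r}"

definition torus_diam :: "(real^3) set \<Rightarrow> real" where
  "torus_diam S = (SUP p\<in>S \<times> S. torus_dist (fst p) (snd p))"


section \<open>Square-integrable fields\<close>

text \<open>
  Elements of \<open>L\<^sup>2\<close> are represented by functions; two functions represent the same element iff
  they agree almost everywhere.
\<close>

definition L2 :: "(real^3 \<Rightarrow> 'b::euclidean_space) set" where
  "L2 = {f. f \<in> borel_measurable borel \<and> periodic f \<and> integrable torus (\<lambda>x. (norm (f x))\<^sup>2)}"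

definition l2_inner :: "(real^3 \<Rightarrow> 'b::euclidean_space) \<Rightarrow> (real^3 \<Rightarrow> 'b) \<Rightarrow> real" where
  "l2_inner f g = (\<integral>x. f x \<bullet> g x \<partial>torus)"

definition l2_norm :: "(real^3 \<Rightarrow> 'b::euclidean_space) \<Rightarrow> real" where
  "l2_norm f = sqrt (l2_inner f f)"

text \<open>Divergence-free is understood in the sense of distributions on the torus.\<close>

definition L2_sigma :: "vfield set" where
  "L2_sigma = {f \<in> L2. \<forall>\<phi>::real^3 \<Rightarrow> real. smooth_on UNIV \<phi> \<longrightarrow> periodic \<phi> \<longrightarrow>
     (\<integral>x. frechet_derivative \<phi> (at x) (f x) \<partial>torus) = 0}"

text \<open>
  \<open>is_leray f g\<close>: \<open>g\<close> represents the orthogonal projection of \<open>f\<close> onto \<open>L2_sigma\<close>; it is determined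
  up to null sets.
\<close>

definition is_leray :: "vfield \<Rightarrow> vfield \<Rightarrow> bool" where
  "is_leray f g \<longleftrightarrow> f \<in> L2 \<and> g \<in> L2_sigma \<and> (\<forall>w\<in>L2_sigma. l2_inner (\<lambda>x. f x - g x) w = 0)"

definition leray :: "vfield \<Rightarrow> vfield" where
  "leray f = (SOME g. is_leray f g)"

text \<open>The adjoint of an operator on the Hilbert space \<open>L2_sigma\<close>, up to null sets.\<close>

definition l2_adjoint :: "(vfield \<Rightarrow> vfield) \<Rightarrow> vfield \<Rightarrow> vfield" where
  "l2_adjoint A g = (SOME w. w \<in> L2_sigma \<and> (\<forall>f\<in>L2_sigma. l2_inner (A f) g = l2_inner f w))"

definition weak_jacobian :: "vfield \<Rightarrow> (real^3 \<Rightarrow> real^3^3) \<Rightarrow> bool" where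
  "weak_jacobian f G \<longleftrightarrow> G \<in> L2 \<and>
     (\<forall>\<phi>::real^3 \<Rightarrow> real. smooth_on UNIV \<phi> \<longrightarrow> periodic \<phi> \<longrightarrow>
       (\<forall>i j. (\<integral>x. f x $ i * frechet_derivative \<phi> (at x) (axis j 1) \<partial>torus)
            = - (\<integral>x. G x $ i $ j * \<phi> x \<partial>torus)))"

text \<open>
  \<open>grad_sq f\<close> is \<open>\<parallel>\<nabla>f\<parallel>\<^sub>2\<^sup>2\<close>, as a functional on \<open>L\<^sup>2\<close> classes. The weak Jacobian is unique up to null
  sets, so the infimum is over at most one value; it is \<open>\<infinity>\<close> when there is no square-integrable
  weak Jacobian. The norm on \<^typ>\<open>real^3^3\<close> is the Frobenius norm.
\<close>

definition grad_sq :: "vfield \<Rightarrow> ennreal" where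
  "grad_sq f = (INF G\<in>{G. weak_jacobian f G}. \<integral>\<^sup>+x. ennreal ((norm (G x))\<^sup>2) \<partial>torus)"


section \<open>The flow and its propagator\<close>

text \<open>
  The equation \<open>\<partial>\<^sub>t h + P[(u \<cdot> \<nabla>)h] = \<nu> \<Delta>h\<close> for times in the interval \<open>I\<close>, with \<open>w\<close> the
  representative of the Leray projection for which it holds at every point.
\<close>

definition transport_eq ::
  "real \<Rightarrow> (real \<Rightarrow> vfield) \<Rightarrow> real set \<Rightarrow> (real \<Rightarrow> vfield) \<Rightarrow> bool" where
  "transport_eq \<nu> u I h \<longleftrightarrow>
     (\<forall>t\<in>I. \<exists>w. is_leray (advect (u t) (h t)) w \<and>
       (\<forall>x. vector_derivative (\<lambda>r. h r x) (at t within I) + w x = \<nu> *\<^sub>R laplacian (h t) x))"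

definition navier_stokes_flow ::
  "real \<Rightarrow> real \<Rightarrow> real \<Rightarrow> (real \<Rightarrow> vfield) \<Rightarrow> bool" where
  "navier_stokes_flow \<nu> tb T u \<longleftrightarrow>
     smooth_on ({tb..<T} \<times> UNIV) (\<lambda>(t, x). u t x) \<and>
     (\<forall>t\<in>{tb..<T}. periodic (u t) \<and> (\<forall>x. divergence (u t) x = 0)) \<and>
     transport_eq \<nu> u {tb..<T} u \<and>
     (\<exists>C. \<forall>t\<in>{tb..<T}. l2_norm (u t) \<le> C) \<and>
     (\<integral>\<^sup>+t\<in>{tb..<T}. grad_sq (u t) \<partial>lborel) < \<infinity>"

text \<open>
  Solutions of the Cauchy problem with initial value \<open>f\<close> at time \<open>s\<close>: continuous into \<open>L2_sigma\<close> on
  \<open>[s, T)\<close> and, by parabolic smoothing, classical for \<open>t > s\<close>. For \<open>t > s\<close> the function \<open>h t\<close> is the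
  smooth representative of its \<open>L\<^sup>2\<close> class.
\<close>

definition cauchy_solution ::
  "real \<Rightarrow> (real \<Rightarrow> vfield) \<Rightarrow> real \<Rightarrow> real \<Rightarrow> vfield \<Rightarrow> (real \<Rightarrow> vfield) \<Rightarrow> bool" where
  "cauchy_solution \<nu> u s T f h \<longleftrightarrow>
     (AE x in lborel. h s x = f x) \<and>
     (\<forall>t\<in>{s..<T}. h t \<in> L2_sigma) \<and>
     (\<forall>t\<in>{s..<T}. ((\<lambda>r. l2_norm (\<lambda>x. h r x - h t x)) \<longlongrightarrow> 0) (at t within {s..<T})) \<and>
     smooth_on ({s<..<T} \<times> UNIV) (\<lambda>(t, x). h t x) \<and>
     transport_eq \<nu> u {s<..<T} h"

text \<open>\<open>U t s\<close> is the solution operator from time \<open>s\<close> to time \<open>t\<close>.\<close>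

definition propagator ::
  "real \<Rightarrow> real \<Rightarrow> real \<Rightarrow> (real \<Rightarrow> vfield) \<Rightarrow> (real \<Rightarrow> real \<Rightarrow> vfield \<Rightarrow> vfield) \<Rightarrow> bool" where
  "propagator \<nu> tb T u U \<longleftrightarrow>
     (\<forall>s\<in>{tb..<T}. \<forall>f\<in>L2_sigma. cauchy_solution \<nu> u s T f (\<lambda>t. U t s f))"


section \<open>Full-tail saturated Hodge families\<close>

definition local_fields :: "(real^3) set \<Rightarrow> vfield set" where
  "local_fields B = {f \<in> L2. \<forall>\<epsilon>>0. \<exists>v. smooth_on UNIV v \<and> periodic v \<and> (\<forall>x. divergence v x = 0) \<and>
     closure {x. v x \<noteq> 0} \<subseteq> B \<and> l2_norm (\<lambda>x. f x - v x) < \<epsilon>}"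

definition harmonic_gradient_on :: "(real^3) set \<Rightarrow> vfield \<Rightarrow> bool" where
  "harmonic_gradient_on B q \<longleftrightarrow> (\<exists>h::real^3 \<Rightarrow> real. periodic h \<and> harmonic_on B h \<and>
     (AE x in lborel. x \<in> B \<longrightarrow> (\<forall>v. q x \<bullet> v = frechet_derivative h (at x) v)))"

definition tail_vanishing :: "(nat \<Rightarrow> nat \<Rightarrow> ennreal) \<Rightarrow> bool" where
  "tail_vanishing a \<longleftrightarrow> (\<lambda>J. SUP (j, k)\<in>{(j, k). J \<le> j \<and> j < k}. a j k) \<longlonglongrightarrow> 0"

definition saturated_hodge_family ::
  "real \<Rightarrow> real \<Rightarrow> real \<Rightarrow> (real \<Rightarrow> real \<Rightarrow> vfield \<Rightarrow> vfield) \<Rightarrow>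
   (nat \<Rightarrow> real) \<Rightarrow> (nat \<Rightarrow> (real^3) set) \<Rightarrow> (nat \<Rightarrow> vfield) \<Rightarrow> bool" where
  "saturated_hodge_family \<nu> tb T U \<tau> B q \<longleftrightarrow>
     strict_mono \<tau> \<and> (\<forall>j. \<tau> j \<in> {tb..<T}) \<and> \<tau> \<longlonglongrightarrow> T \<and>
     (\<forall>j. \<exists>c r. r > 0 \<and> B j = torus_ball c r) \<and>
     (\<forall>j. closure (B (Suc j)) \<subseteq> B j) \<and>
     (\<lambda>j. torus_diam (B j)) \<longlonglongrightarrow> 0 \<and>
     (\<forall>i j. l2_inner (q i) (q j) = (if i = j then 1 else 0)) \<and>
     (\<forall>j. q j \<in> local_fields (B j) \<and> (\<forall>w\<in>local_fields (B (Suc j)). l2_inner (q j) w = 0)) \<and>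
     (\<forall>j. AE x in lborel. x \<notin> B j \<longrightarrow> q j x = 0) \<and>
     (\<forall>j. harmonic_gradient_on (B (Suc j)) (q j)) \<and>
     tail_vanishing (\<lambda>j k. ennreal (l2_norm (\<lambda>x. U (\<tau> k) (\<tau> j) (q j) x - q k x))) \<and>
     tail_vanishing (\<lambda>j k. ennreal (l2_norm (\<lambda>x. l2_adjoint (U (\<tau> k) (\<tau> j)) (q k) x - q j x))) \<and>
     tail_vanishing (\<lambda>j k. ennreal (2 * \<nu>) *
       (\<integral>\<^sup>+t\<in>{\<tau> j..\<tau> k}. grad_sq (U t (\<tau> j) (q j)) \<partial>lborel)) \<and>
     tail_vanishing (\<lambda>j k. ennreal (2 * \<nu>) *
       (\<integral>\<^sup>+t\<in>{\<tau> j..\<tau> k}. grad_sq (l2_adjoint (U (\<tau> k) t) (q k)) \<partial>lborel))"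

definition production ::
  "(real \<Rightarrow> vfield) \<Rightarrow> (real \<Rightarrow> real \<Rightarrow> vfield \<Rightarrow> vfield) \<Rightarrow>
   (nat \<Rightarrow> real) \<Rightarrow> (nat \<Rightarrow> vfield) \<Rightarrow> nat \<Rightarrow> real \<Rightarrow> real" where
  "production u U \<tau> q J t =
     (let H = U t (\<tau> J) (q J) in l2_inner (laplacian H) (leray (advect (u t) H)))"

end

theory Submission
  imports Defs
begin

text \<open>
  Let \<open>H(t) = U(t, \<tau>\<^sub>J) q\<^sub>J\<close> and \<open>E(t) = \<parallel>\<nabla>H(t)\<parallel>\<^sup>2\<close>. Pairing the equation for \<open>H\<close> with \<open>\<Delta>H\<close> gives
  \<open>E' = 2 P\<^sub>J - 2 \<nu> \<parallel>\<Delta>H\<parallel>\<^sup>2 \<le> 2 P\<^sub>J\<close>, so if the positive part of the production had a finite integral,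
  then \<open>E\<close> would stay bounded up to the final time. The lemmas \<open>dirichlet_energy_has_derivative\<close> and
  \<open>time_derivative_le_production\<close> are this energy inequality.

  A bounded gradient is incompatible with concentration. For large \<open>J\<close> the field \<open>H(\<tau>\<^sub>k)\<close> is close to the
  unit vector \<open>q\<^sub>k\<close>, which is supported in \<open>B\<^sub>k\<close>. Shift by \<open>s e\<^sub>1\<close> with \<open>s \<le> 1/2\<close> larger than the diameter
  of \<open>B\<^sub>k\<close>: the shifted \<open>q\<^sub>k\<close> has support disjoint from that of \<open>q\<^sub>k\<close>, so \<open>H(\<tau>\<^sub>k)\<close> moves in \<open>L\<^sup>2\<close> by a fixed
  amount (\<open>shift_difference_ge_of_concentrated\<close>). On the other hand it moves by at most \<open>s E(\<tau>\<^sub>k)\<^sup>1\<^sup>/\<^sup>2\<close>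
  (\<open>integral_shift_difference_le\<close>). Fixing \<open>s\<close> small in terms of the bound on \<open>E\<close> and then taking \<open>k\<close> so large
  that \<open>B\<^sub>k\<close> has diameter below \<open>s\<close> gives a contradiction.

  All integrals over the torus rest on translation invariance along a coordinate axis: it yields the
  shift estimates and, by differentiating in the shift, integration by parts.
\<close>

section \<open>Integration over the torus\<close>

lemma nn_integral_lborel_shift:
  fixes c :: "'a::euclidean_space"
  assumes "g \<in> borel_measurable borel"
  shows "(\<integral>\<^sup>+x. g (x + c) \<partial>lborel) = (\<integral>\<^sup>+x. g x \<partial>lborel)"
proof -
  have "(\<integral>\<^sup>+x. g x \<partial>lborel) = (\<integral>\<^sup>+x. g x \<partial>distr lborel borel ((+) c))"
    by (simp add: lborel_distr_plus)
  also have "\<dots> = (\<integral>\<^sup>+x. g (c + x) \<partial>lborel)"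
    using assms by (intro nn_integral_distr) auto
  finally show ?thesis by (simp add: add.commute)
qed

lemma measurable_torus:
  "f \<in> borel_measurable borel \<Longrightarrow> f \<in> borel_measurable torus"
  unfolding torus_def by (intro measurable_restrict_space1) auto

lemma AE_lborel_imp_torus: "AE x in lborel. P x \<Longrightarrow> AE x in torus. P x"
  unfolding torus_def by (subst AE_restrict_space_iff) auto

lemma cube_half_open_AE:
  "AE x::real^3 in lborel. indicator (cbox 0 1) x = (indicator {x. \<forall>j. 0 \<le> x $ j \<and> x $ j < 1} x :: ennreal)"
proof -
  have "{x \<in> space lborel. indicator (cbox 0 1) x \<noteq> (indicator {x. \<forall>j. 0 \<le> x $ j \<and> x $ j < 1} x :: ennreal)}
      \<subseteq> cbox 0 1 - box 0 (1::real^3)"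
    by (auto simp: mem_box_cart indicator_def less_le split: if_splits)
  moreover have "emeasure lborel (cbox 0 1 - box 0 (1::real^3)) = 0"
    by (subst emeasure_Diff) (auto simp: emeasure_lborel_cbox_eq emeasure_lborel_box_eq box_subset_cbox)
  then have "cbox 0 1 - box 0 (1::real^3) \<in> null_sets lborel" by (intro null_setsI) auto
  ultimately show ?thesis by (intro AE_I')
qed

lemma periodic_axis: "periodic f \<Longrightarrow> f (x + axis i 1) = f x"
  unfolding periodic_def lattice_def by (auto simp: axis_def)

text \<open>
  Shifting the half-open cube by \<open>s\<close> along one axis replaces its slab \<open>0 \<le> x\<^sub>i < s\<close> by the slab
  \<open>1 \<le> x\<^sub>i < 1 + s\<close>, which is a translate of it by one period.
\<close>

lemma nn_integral_torus_shift:
  fixes f :: "real^3 \<Rightarrow> ennreal"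
  assumes f [measurable]: "f \<in> borel_measurable borel" and "periodic f" "0 \<le> s" "s \<le> 1"
  shows "(\<integral>\<^sup>+x. f (x + s *\<^sub>R axis i 1) \<partial>torus) = (\<integral>\<^sup>+x. f x \<partial>torus)"
proof -
  define L where "L a b = {x::real^3. (\<forall>j. j \<noteq> i \<longrightarrow> 0 \<le> x $ j \<and> x $ j < 1) \<and> a \<le> x $ i \<and> x $ i < b}"
    for a b
  have L [measurable]: "L a b \<in> sets borel" for a b unfolding L_def by measurable
  have cube: "(\<integral>\<^sup>+x. g x \<partial>torus) = (\<integral>\<^sup>+x. g x * indicator (L 0 1) x \<partial>lborel)"
    for g :: "real^3 \<Rightarrow> ennreal"
  proof -
    have "L 0 1 = {x. \<forall>j. 0 \<le> x $ j \<and> x $ j < 1}" by (auto simp: L_def)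
    then show ?thesis
      unfolding torus_def using cube_half_open_AE
      by (subst nn_integral_restrict_space) (auto intro!: nn_integral_cong_AE)
  qed
  have ind: "indicator (L a b) x = (indicator (L (a + r) (b + r)) (x + r *\<^sub>R axis i 1) :: ennreal)"
    for a b r x by (auto simp: L_def indicator_def axis_def)
  have move: "(\<integral>\<^sup>+x. f (x + r *\<^sub>R axis i 1) * indicator (L a b) x \<partial>lborel)
      = (\<integral>\<^sup>+x. f x * indicator (L (a + r) (b + r)) x \<partial>lborel)" for a b r
  proof -
    let ?g = "\<lambda>x. f x * indicator (L (a + r) (b + r)) x"
    have "?g \<in> borel_measurable borel" by measurable
    from nn_integral_lborel_shift[OF this, of "r *\<^sub>R axis i 1"] show ?thesis
      by (simp only: ind[of a b _ r])
  qed
  \<comment> \<open>Half-open slabs tile exactly.\<close>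
  have split: "(\<integral>\<^sup>+x. f x * indicator (L a c) x \<partial>lborel)
      = (\<integral>\<^sup>+x. f x * indicator (L a b) x \<partial>lborel) + (\<integral>\<^sup>+x. f x * indicator (L b c) x \<partial>lborel)"
    if "a \<le> b" "b \<le> c" for a b c
  proof -
    have "indicator (L a c) x = (indicator (L a b) x + indicator (L b c) x :: ennreal)" for x
      using that by (auto simp: L_def indicator_def)
    then show ?thesis by (simp add: distrib_left nn_integral_add)
  qed
  have "(\<integral>\<^sup>+x. f (x + s *\<^sub>R axis i 1) \<partial>torus) = (\<integral>\<^sup>+x. f x * indicator (L s (1 + s)) x \<partial>lborel)"
    using move[of s 0 1] by (simp add: cube)
  also have "\<dots> = (\<integral>\<^sup>+x. f x * indicator (L s 1) x \<partial>lborel)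
      + (\<integral>\<^sup>+x. f x * indicator (L 1 (1 + s)) x \<partial>lborel)"
    using assms by (intro split) auto
  also have "(\<integral>\<^sup>+x. f x * indicator (L 1 (1 + s)) x \<partial>lborel) = (\<integral>\<^sup>+x. f x * indicator (L 0 s) x \<partial>lborel)"
    using move[of 1 0 s] \<open>periodic f\<close> by (simp add: periodic_axis add.commute)
  also have "(\<integral>\<^sup>+x. f x * indicator (L s 1) x \<partial>lborel) + (\<integral>\<^sup>+x. f x * indicator (L 0 s) x \<partial>lborel)
      = (\<integral>\<^sup>+x. f x * indicator (L 0 1) x \<partial>lborel)"
    using assms by (subst split[of 0 s 1]) (auto simp: add.commute)
  finally show ?thesis by (simp add: cube)
qed

lemma
  fixes f :: "real^3 \<Rightarrow> real"
  assumes f [measurable]: "f \<in> borel_measurable borel" and per: "periodic f"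
    and int: "integrable torus f" and s: "0 \<le> s" "s \<le> 1"
  shows integrable_torus_shift: "integrable torus (\<lambda>x. f (x + s *\<^sub>R axis i 1))"
    and integral_torus_shift: "(\<integral>x. f (x + s *\<^sub>R axis i 1) \<partial>torus) = (\<integral>x. f x \<partial>torus)"
proof -
  have shift: "(\<integral>\<^sup>+x. ennreal (g (f (x + s *\<^sub>R axis i 1))) \<partial>torus) = (\<integral>\<^sup>+x. ennreal (g (f x)) \<partial>torus)"
    if [measurable]: "g \<in> borel_measurable borel" for g :: "real \<Rightarrow> real"
    using per s by (intro nn_integral_torus_shift[where f = "\<lambda>x. ennreal (g (f x))"]) (auto simp: periodic_def)
  show int': "integrable torus (\<lambda>x. f (x + s *\<^sub>R axis i 1))"
    using int shift[of abs] by (auto simp: integrable_iff_bounded intro!: measurable_torus)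
  show "(\<integral>x. f (x + s *\<^sub>R axis i 1) \<partial>torus) = (\<integral>x. f x \<partial>torus)"
    using shift[of id] shift[of uminus] by (simp add: real_lebesgue_integral_def int int')
qed

lemma
  fixes f :: "real^3 \<Rightarrow> 'b::euclidean_space"
  assumes "continuous_on UNIV f"
  shows integrable_torus_continuous: "integrable torus f"
    and integral_torus_continuous: "(\<integral>x. f x \<partial>torus) = integral (cbox 0 1) f"
proof -
  have int: "set_integrable lborel (cbox 0 1) f"
    unfolding set_integrable_def
    using assms by (intro borel_integrable_compact) (auto intro: continuous_on_subset)
  then show "integrable torus f"
    unfolding torus_def set_integrable_def by (subst integrable_restrict_space) auto
  show "(\<integral>x. f x \<partial>torus) = integral (cbox 0 1) f"
    using set_borel_integral_eq_integral(2)[OF int]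
    unfolding torus_def set_lebesgue_integral_def by (subst integral_restrict_space) auto
qed

lemma continuous_on_slice:
  assumes "continuous_on (S \<times> UNIV) (\<lambda>(s, x). f s x)" "s \<in> S"
  shows "continuous_on UNIV (f s)"
proof -
  have "continuous_on UNIV (\<lambda>x. (case (s, x) of (s, x) \<Rightarrow> f s x))"
    using assms by (intro continuous_on_compose2[OF assms(1)]) (auto intro!: continuous_intros)
  then show ?thesis by simp
qed

lemma continuous_on_integral_torus:
  fixes f :: "'a::topological_space \<Rightarrow> real^3 \<Rightarrow> 'b::euclidean_space"
  assumes "continuous_on (S \<times> UNIV) (\<lambda>(s, x). f s x)"
  shows "continuous_on S (\<lambda>s. \<integral>x. f s x \<partial>torus)"
proof -
  have "continuous_on UNIV (f s)" if "s \<in> S" for s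
    using assms that by (rule continuous_on_slice)
  then have "(\<integral>x. f s x \<partial>torus) = integral (cbox 0 1) (f s)" if "s \<in> S" for s
    using that by (intro integral_torus_continuous)
  moreover have "continuous_on S (\<lambda>s. integral (cbox 0 1) (f s))"
    using assms by (intro integral_continuous_on_param) (auto elim: continuous_on_subset)
  ultimately show ?thesis by (simp cong: continuous_on_cong)
qed

lemma has_vector_derivative_integral_torus:
  fixes f :: "real \<Rightarrow> real^3 \<Rightarrow> 'b::euclidean_space"
  assumes deriv: "\<And>s x. s \<in> S \<Longrightarrow> ((\<lambda>s. f s x) has_vector_derivative f' s x) (at s within S)"
    and cont: "\<And>s. s \<in> S \<Longrightarrow> continuous_on UNIV (f s)"
    and cont': "continuous_on (S \<times> UNIV) (\<lambda>(s, x). f' s x)"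
    and S: "s \<in> S" "convex S"
  shows "((\<lambda>s. \<integral>x. f s x \<partial>torus) has_vector_derivative (\<integral>x. f' s x \<partial>torus)) (at s within S)"
proof -
  have "continuous_on UNIV (f' s)"
    using cont' S(1) by (rule continuous_on_slice)
  then have "(\<integral>x. f' s x \<partial>torus) = integral (cbox 0 1) (f' s)"
    by (rule integral_torus_continuous)
  moreover have "((\<lambda>s. integral (cbox 0 1) (f s)) has_vector_derivative integral (cbox 0 1) (f' s)) (at s within S)"
    using S
    by (intro leibniz_rule_vector_derivative deriv integrable_continuous
        continuous_on_subset[OF cont] continuous_on_subset[OF cont']) auto
  ultimately have "((\<lambda>s. integral (cbox 0 1) (f s)) has_vector_derivative (\<integral>x. f' s x \<partial>torus)) (at s within S)"
    by simp
  then show ?thesis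
    by (rule has_vector_derivative_transform[OF S(1), rotated]) (rule integral_torus_continuous[OF cont])
qed

text \<open>
  The function \<open>s \<mapsto> \<integral> f (x + s e\<^sub>i)\<close> is constant by translation invariance, and its derivative at
  \<open>0\<close> is the integral of \<open>\<partial>\<^sub>i f\<close>. One-sided derivatives suffice, so only shifts in \<open>[0, 1]\<close> occur.
\<close>

lemma integral_torus_axis_derivative:
  fixes f :: "real^3 \<Rightarrow> real"
  assumes per: "periodic f" and diff: "f differentiable_on UNIV"
    and cont: "continuous_on UNIV (\<lambda>x. frechet_derivative f (at x) (axis i 1))"
  shows "(\<integral>x. frechet_derivative f (at x) (axis i 1) \<partial>torus) = 0"
proof -
  let ?g = "\<lambda>x. frechet_derivative f (at x) (axis i 1)"
  have D: "(f has_derivative frechet_derivative f (at x)) (at x)" for x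
    using diff by (auto simp: differentiable_on_def frechet_derivative_works)
  have cf: "continuous_on UNIV f" using diff by (rule differentiable_imp_continuous_on)
  have "((\<lambda>s. f (x + s *\<^sub>R axis i 1)) has_vector_derivative ?g (x + s *\<^sub>R axis i 1)) (at s within {0..1})" for s x
  proof -
    have "((\<lambda>s. f (x + s *\<^sub>R axis i 1)) has_derivative
        (\<lambda>h. frechet_derivative f (at (x + s *\<^sub>R axis i 1)) (h *\<^sub>R axis i 1))) (at s within {0..1})"
      by (rule has_derivative_compose[OF _ D]) (auto intro!: derivative_eq_intros)
    moreover have "linear (frechet_derivative f (at (x + s *\<^sub>R axis i 1)))"
      using D has_derivative_linear by blast
    ultimately show ?thesis
      by (simp add: has_vector_derivative_def linear_cmul)
  qed
  moreover have "continuous_on UNIV (\<lambda>x. f (x + s *\<^sub>R axis i 1))" for s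
    by (rule continuous_on_compose2[OF cf]) (auto intro!: continuous_intros)
  moreover have "continuous_on ({0..1} \<times> UNIV) (\<lambda>(s, x). ?g (x + s *\<^sub>R axis i 1))"
    unfolding split_beta
    by (rule continuous_on_compose2[OF cont]) (auto intro!: continuous_intros)
  ultimately have "((\<lambda>s. \<integral>x. f (x + s *\<^sub>R axis i 1) \<partial>torus) has_vector_derivative
      (\<integral>x. ?g (x + 0 *\<^sub>R axis i 1) \<partial>torus)) (at 0 within {0..1})"
    by (intro has_vector_derivative_integral_torus) auto
  then have "((\<lambda>s. \<integral>x. f x \<partial>torus) has_vector_derivative (\<integral>x. ?g (x + 0 *\<^sub>R axis i 1) \<partial>torus)) (at 0 within {0..1})"
  proof (rule has_vector_derivative_transform[rotated 2])
    show "(\<integral>x. f x \<partial>torus) = (\<integral>x. f (x + s *\<^sub>R axis i 1) \<partial>torus)" if "s \<in> {0..1}" for s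
      using that per cf
      by (intro integral_torus_shift[symmetric] borel_measurable_continuous_onI integrable_torus_continuous) auto
  qed auto
  then have "((\<lambda>s. \<integral>x. f x \<partial>torus) has_vector_derivative (\<integral>x. ?g x \<partial>torus)) (at 0 within {0..1})"
    by simp
  moreover have "((\<lambda>s. \<integral>x. f x \<partial>torus) has_vector_derivative 0) (at 0 within {0..1::real})"
    by (rule has_vector_derivative_const)
  ultimately show ?thesis
    by (rule vector_derivative_unique_within[rotated]) (simp add: at_within_Icc_at_right)
qed

section \<open>Square-integrable fields\<close>

lemma l2_norm_nonneg: "l2_norm f \<ge> 0"
  by (simp add: l2_norm_def l2_inner_def)

lemma l2_norm_sq: "(l2_norm f)\<^sup>2 = (\<integral>x. (norm (f x))\<^sup>2 \<partial>torus)"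
  by (simp add: l2_norm_def l2_inner_def power2_norm_eq_inner)

lemma L2_D:
  assumes "f \<in> L2"
  shows "f \<in> borel_measurable borel" "periodic f" "integrable torus (\<lambda>x. (norm (f x))\<^sup>2)"
  using assms by (auto simp: L2_def)

lemma integrable_inner_L2:
  assumes "f \<in> L2" "g \<in> L2"
  shows "integrable torus (\<lambda>x. f x \<bullet> g x)"
proof (rule Bochner_Integration.integrable_bound)
  show "integrable torus (\<lambda>x. (norm (f x))\<^sup>2 + (norm (g x))\<^sup>2)"
    using assms by (intro Bochner_Integration.integrable_add L2_D)
  show "(\<lambda>x. f x \<bullet> g x) \<in> borel_measurable torus"
    using assms by (intro borel_measurable_inner measurable_torus L2_D)
  have "\<bar>f x \<bullet> g x\<bar> \<le> (norm (f x))\<^sup>2 + (norm (g x))\<^sup>2" for x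
  proof -
    have "\<bar>f x \<bullet> g x\<bar> \<le> norm (f x) * norm (g x)" by (rule Cauchy_Schwarz_ineq2)
    also have "\<dots> \<le> (norm (f x))\<^sup>2 + (norm (g x))\<^sup>2"
      using sum_squares_bound[of "norm (f x)" "norm (g x)"] mult_nonneg_nonneg[of "norm (f x)" "norm (g x)"]
      by (auto simp del: mult_nonneg_nonneg)
    finally show ?thesis .
  qed
  then show "AE x in torus. norm (f x \<bullet> g x) \<le> norm ((norm (f x))\<^sup>2 + (norm (g x))\<^sup>2)"
    by auto
qed

lemma L2_diff:
  assumes "f \<in> L2" "g \<in> L2"
  shows "(\<lambda>x. f x - g x) \<in> L2"
proof -
  have "integrable torus (\<lambda>x. (norm (f x))\<^sup>2 - 2 * (f x \<bullet> g x) + (norm (g x))\<^sup>2)"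
    using assms
    by (intro Bochner_Integration.integrable_add Bochner_Integration.integrable_diff
        integrable_mult_right integrable_inner_L2 L2_D)
  moreover have "(\<lambda>x. (norm (f x))\<^sup>2 - 2 * (f x \<bullet> g x) + (norm (g x))\<^sup>2) = (\<lambda>x. (norm (f x - g x))\<^sup>2)"
    by (auto simp: power2_norm_eq_inner inner_diff inner_commute)
  ultimately show ?thesis
    using assms by (auto simp: L2_def periodic_def)
qed

lemma L2_continuous:
  assumes "continuous_on UNIV f" "periodic f"
  shows "f \<in> L2"
  using assms unfolding L2_def
  by (auto intro!: borel_measurable_continuous_onI integrable_torus_continuous continuous_intros)

text \<open>
  The Cauchy--Schwarz inequality with a free parameter \<open>c\<close>: a small \<open>g\<close> is absorbed by choosing \<open>c\<close>
  small, whatever the size of \<open>f\<close>.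
\<close>

lemma abs_l2_inner_le:
  assumes "f \<in> L2" "g \<in> L2" "c > 0"
  shows "2 * \<bar>l2_inner f g\<bar> \<le> c * (l2_norm f)\<^sup>2 + (l2_norm g)\<^sup>2 / c"
proof -
  have "\<bar>2 * (f x \<bullet> g x)\<bar> \<le> c * (norm (f x))\<^sup>2 + (norm (g x))\<^sup>2 / c" for x
  proof -
    have "0 \<le> c\<^sup>2 * (f x \<bullet> f x) + 2 * c * (f x \<bullet> g x) + g x \<bullet> g x"
      using inner_ge_zero[of "c *\<^sub>R f x + g x"]
      by (simp add: inner_add inner_commute power2_eq_square algebra_simps)
    moreover have "0 \<le> c\<^sup>2 * (f x \<bullet> f x) - 2 * c * (f x \<bullet> g x) + g x \<bullet> g x"
      using inner_ge_zero[of "c *\<^sub>R f x - g x"]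
      by (simp add: inner_diff inner_commute power2_eq_square algebra_simps)
    ultimately have "c * \<bar>2 * (f x \<bullet> g x)\<bar> \<le> c * (c * (f x \<bullet> f x) + g x \<bullet> g x / c)"
      using \<open>c > 0\<close> by (auto simp: abs_if power2_eq_square algebra_simps)
    then show ?thesis using \<open>c > 0\<close> by (simp add: power2_norm_eq_inner)
  qed
  then have "(\<integral>x. \<bar>2 * (f x \<bullet> g x)\<bar> \<partial>torus) \<le> (\<integral>x. c * (norm (f x))\<^sup>2 + (norm (g x))\<^sup>2 / c \<partial>torus)"
    using assms
    by (intro integral_mono Bochner_Integration.integrable_add integrable_abs
        integrable_mult_right integrable_divide integrable_inner_L2 L2_D) auto
  also have "\<dots> = c * (l2_norm f)\<^sup>2 + (l2_norm g)\<^sup>2 / c"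
    using assms by (simp add: l2_norm_sq L2_D)
  finally have "(\<integral>x. \<bar>2 * (f x \<bullet> g x)\<bar> \<partial>torus) \<le> c * (l2_norm f)\<^sup>2 + (l2_norm g)\<^sup>2 / c" .
  moreover have "\<bar>\<integral>x. 2 * (f x \<bullet> g x) \<partial>torus\<bar> \<le> (\<integral>x. \<bar>2 * (f x \<bullet> g x)\<bar> \<partial>torus)"
    by (rule integral_abs_bound)
  ultimately have "\<bar>\<integral>x. 2 * (f x \<bullet> g x) \<partial>torus\<bar> \<le> c * (l2_norm f)\<^sup>2 + (l2_norm g)\<^sup>2 / c"
    by linarith
  then show ?thesis
    by (simp add: l2_inner_def abs_mult)
qed

section \<open>Integration by parts\<close>

lemma has_derivative_frechet:
  "f differentiable_on UNIV \<Longrightarrow> (f has_derivative frechet_derivative f (at x)) (at x)"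
  by (auto simp: differentiable_on_def frechet_derivative_works)

lemma smooth_on_UNIV_D:
  assumes "smooth_on UNIV f"
  shows "f differentiable_on UNIV" "continuous_on UNIV (\<lambda>x. frechet_derivative f (at x) v)"
proof -
  have "Ck_on 1 UNIV f" using assms by (simp add: smooth_on_def)
  then show "f differentiable_on UNIV" "continuous_on UNIV (\<lambda>x. frechet_derivative f (at x) v)"
    by simp_all
qed

lemma Basis_vec3: "(Basis :: (real^3) set) = (\<lambda>i. axis i 1) ` UNIV"
  by (auto simp: Basis_vec_def)

lemma sum_Basis_vec3: "(\<Sum>b\<in>Basis. g (b :: real^3)) = (\<Sum>i\<in>UNIV. g (axis i 1))"
  unfolding Basis_vec3 by (subst sum.reindex) (auto intro!: injI simp: axis_eq_axis)

lemma linear_axis_sum: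
  fixes L :: "real^3 \<Rightarrow> 'b::real_vector"
  assumes "linear L"
  shows "L v = (\<Sum>i\<in>UNIV. v $ i *\<^sub>R L (axis i 1))"
proof -
  have "L v = L (\<Sum>i\<in>UNIV. v $ i *\<^sub>R axis i 1)"
    by (simp add: basis_expansion scalar_mult_eq_scaleR[symmetric])
  then show ?thesis
    using assms by (simp add: linear_sum linear_cmul)
qed

lemma periodic_frechet_derivative:
  fixes f :: "real^3 \<Rightarrow> 'b::real_normed_vector"
  assumes "periodic f"
  shows "periodic (\<lambda>x. frechet_derivative f (at x) v)"
proof -
  have shift: "(f has_derivative D) (at x)" if "z \<in> lattice" "(f has_derivative D) (at (x + z))" for x z D
  proof -
    have "((\<lambda>y. y + z) has_derivative (\<lambda>h. h)) (at x)" by (auto intro!: derivative_eq_intros)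
    from has_derivative_compose[OF this that(2)]
    show ?thesis using assms that by (simp add: periodic_def)
  qed
  have "(f has_derivative D) (at (x + z)) \<longleftrightarrow> (f has_derivative D) (at x)" if z: "z \<in> lattice" for x z D
  proof
    have "- z \<in> lattice" using z by (auto simp: lattice_def)
    then show "(f has_derivative D) (at (x + z))" if "(f has_derivative D) (at x)"
      by (rule shift) (simp add: that)
  qed (rule shift[OF z])
  then show ?thesis by (simp add: periodic_def frechet_derivative_def)
qed

lemma integral_torus_by_parts:
  fixes f g :: "real^3 \<Rightarrow> 'b::euclidean_space"
  assumes per: "periodic f" "periodic g"
    and f: "\<And>x. (f has_derivative f' x) (at x)" and g: "\<And>x. (g has_derivative g' x) (at x)"
    and f': "continuous_on UNIV (\<lambda>x. f' x (axis i 1))" and g': "continuous_on UNIV (\<lambda>x. g' x (axis i 1))"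
  shows "(\<integral>x. f' x (axis i 1) \<bullet> g x \<partial>torus) = - (\<integral>x. f x \<bullet> g' x (axis i 1) \<partial>torus)"
proof -
  have D: "((\<lambda>x. f x \<bullet> g x) has_derivative (\<lambda>h. f x \<bullet> g' x h + f' x h \<bullet> g x)) (at x)" for x
    by (rule has_derivative_inner[OF f g])
  then have eq: "frechet_derivative (\<lambda>x. f x \<bullet> g x) (at x) = (\<lambda>h. f x \<bullet> g' x h + f' x h \<bullet> g x)" for x
    by (rule frechet_derivative_at[symmetric])
  have c: "continuous_on UNIV f" "continuous_on UNIV g"
    by (rule has_derivative_continuous_on[OF has_derivative_at_withinI[OF f]]
        has_derivative_continuous_on[OF has_derivative_at_withinI[OF g]])+
  have "(\<lambda>x. f x \<bullet> g x) differentiable_on UNIV"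
    using D unfolding differentiable_on_def differentiable_def by blast
  then have "(\<integral>x. frechet_derivative (\<lambda>x. f x \<bullet> g x) (at x) (axis i 1) \<partial>torus) = 0"
  proof (rule integral_torus_axis_derivative[rotated])
    show "periodic (\<lambda>x. f x \<bullet> g x)" using per by (simp add: periodic_def)
    show "continuous_on UNIV (\<lambda>x. frechet_derivative (\<lambda>x. f x \<bullet> g x) (at x) (axis i 1))"
      unfolding eq by (intro continuous_intros c f' g')
  qed
  then have "(\<integral>x. f x \<bullet> g' x (axis i 1) + f' x (axis i 1) \<bullet> g x \<partial>torus) = 0"
    by (simp add: eq)
  also have "(\<integral>x. f x \<bullet> g' x (axis i 1) + f' x (axis i 1) \<bullet> g x \<partial>torus)
      = (\<integral>x. f x \<bullet> g' x (axis i 1) \<partial>torus) + (\<integral>x. f' x (axis i 1) \<bullet> g x \<partial>torus)"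
    using c f' g' by (intro Bochner_Integration.integral_add integrable_torus_continuous continuous_intros)
  finally show ?thesis by simp
qed

section \<open>Divergence-free fields and the Leray projection\<close>

definition grad :: "(real^3 \<Rightarrow> real) \<Rightarrow> vfield" where
  "grad \<phi> x = (\<chi> i. frechet_derivative \<phi> (at x) (axis i 1))"

lemma frechet_derivative_eq_grad:
  assumes "\<phi> differentiable_on UNIV"
  shows "frechet_derivative \<phi> (at x) v = grad \<phi> x \<bullet> v"
  using linear_axis_sum[OF has_derivative_linear[OF has_derivative_frechet[OF assms]], of x v]
  by (simp add: grad_def inner_vec_def mult.commute)

lemma grad_L2:
  assumes "smooth_on UNIV \<phi>" "periodic \<phi>"
  shows "grad \<phi> \<in> L2"
proof (rule L2_continuous)
  show "continuous_on UNIV (grad \<phi>)"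
    unfolding grad_def[abs_def]
    using smooth_on_UNIV_D[OF assms(1)] by (auto intro!: continuous_intros)
  show "periodic (grad \<phi>)"
    using periodic_frechet_derivative[OF assms(2)] by (simp add: periodic_def grad_def)
qed

lemma L2_sigma_iff:
  "f \<in> L2_sigma \<longleftrightarrow> f \<in> L2 \<and> (\<forall>\<phi>. smooth_on UNIV \<phi> \<longrightarrow> periodic \<phi> \<longrightarrow> l2_inner (grad \<phi>) f = 0)"
  unfolding L2_sigma_def l2_inner_def
  by (auto simp: frechet_derivative_eq_grad smooth_on_UNIV_D)

lemma l2_inner_diff_right:
  assumes "f \<in> L2" "g \<in> L2" "h \<in> L2"
  shows "l2_inner f (\<lambda>x. g x - h x) = l2_inner f g - l2_inner f h"
  unfolding l2_inner_def inner_diff_right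
  using assms by (intro Bochner_Integration.integral_diff integrable_inner_L2)

lemma L2_sigma_diff:
  "f \<in> L2_sigma \<Longrightarrow> g \<in> L2_sigma \<Longrightarrow> (\<lambda>x. f x - g x) \<in> L2_sigma"
  by (simp add: L2_sigma_iff L2_diff l2_inner_diff_right grad_L2)

text \<open>
  Two representatives of the projection differ by a field \<open>d\<close> in \<^const>\<open>L2_sigma\<close> that is orthogonal to
  \<^const>\<open>L2_sigma\<close>, hence to itself. So pairings do not see which representative \<^const>\<open>leray\<close>
  picks, and the one from the evolution equation can be used instead.
\<close>

lemma l2_inner_leray:
  assumes w: "is_leray f w" and X: "X \<in> L2"
  shows "l2_inner X (leray f) = l2_inner X w"
proof -
  define d where "d x = leray f x - w x" for x
  have g: "is_leray f (leray f)" unfolding leray_def using w by (rule someI[of "is_leray f"])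
  have L2: "f \<in> L2" "leray f \<in> L2" "w \<in> L2" using g w by (auto simp: is_leray_def L2_sigma_iff)
  have d: "d \<in> L2_sigma"
    unfolding d_def[abs_def] using g w by (intro L2_sigma_diff) (auto simp: is_leray_def)
  then have dL2: "d \<in> L2" by (simp add: L2_sigma_iff)
  have "(\<integral>x. (f x - w x) \<bullet> d x \<partial>torus) - (\<integral>x. (f x - leray f x) \<bullet> d x \<partial>torus) = 0"
    using g w d by (simp add: is_leray_def l2_inner_def)
  also have "(\<integral>x. (f x - w x) \<bullet> d x \<partial>torus) - (\<integral>x. (f x - leray f x) \<bullet> d x \<partial>torus)
      = (\<integral>x. (f x - w x) \<bullet> d x - (f x - leray f x) \<bullet> d x \<partial>torus)"
    using L2 dL2 by (intro Bochner_Integration.integral_diff[symmetric] integrable_inner_L2 L2_diff)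
  also have "(\<lambda>x. (f x - w x) \<bullet> d x - (f x - leray f x) \<bullet> d x) = (\<lambda>x. d x \<bullet> d x)"
    by (simp add: d_def inner_diff_left[symmetric])
  finally have "(\<integral>x. d x \<bullet> d x \<partial>torus) = 0" .
  then have "AE x in torus. d x \<bullet> d x = 0"
    using integrable_inner_L2[OF dL2 dL2] by (subst (asm) integral_nonneg_eq_0_iff_AE) auto
  then have "l2_inner X d = 0"
    unfolding l2_inner_def by (intro integral_eq_zero_AE) auto
  then show ?thesis
    using l2_inner_diff_right[OF X L2(2,3)] by (simp add: d_def[abs_def])
qed

lemma l2_inner_grad_solenoidal:
  assumes \<phi>: "smooth_on UNIV \<phi>" "periodic \<phi>"
    and v: "smooth_on UNIV v" "periodic v" "\<And>x. divergence v x = 0"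
  shows "l2_inner (grad \<phi>) v = 0"
proof -
  note D\<phi> = has_derivative_frechet[OF smooth_on_UNIV_D(1)[OF \<phi>(1)]]
  note Dv = has_derivative_frechet[OF smooth_on_UNIV_D(1)[OF v(1)]]
  note c = smooth_on_UNIV_D(2)[OF \<phi>(1)] smooth_on_UNIV_D(2)[OF v(1)]
    differentiable_imp_continuous_on[OF smooth_on_UNIV_D(1)[OF \<phi>(1)]]
    differentiable_imp_continuous_on[OF smooth_on_UNIV_D(1)[OF v(1)]]
  have parts: "(\<integral>x. frechet_derivative \<phi> (at x) (axis i 1) * v x $ i \<partial>torus)
      = - (\<integral>x. \<phi> x * frechet_derivative v (at x) (axis i 1) $ i \<partial>torus)" for i
  proof -
    have "((\<lambda>x. v x $ i) has_derivative (\<lambda>h. frechet_derivative v (at x) h $ i)) (at x)" for x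
      by (intro bounded_linear.has_derivative[OF bounded_linear_vec_nth] Dv)
    moreover have "continuous_on UNIV (\<lambda>x. frechet_derivative v (at x) (axis i 1) $ i)"
      using c(2) by (rule continuous_on_component)
    moreover have "periodic (\<lambda>x. v x $ i)" using v(2) by (simp add: periodic_def)
    ultimately show ?thesis
      using integral_torus_by_parts[OF \<phi>(2) _ D\<phi> _ c(1)] by fastforce
  qed
  have "l2_inner (grad \<phi>) v = (\<integral>x. (\<Sum>i\<in>UNIV. frechet_derivative \<phi> (at x) (axis i 1) * v x $ i) \<partial>torus)"
    by (simp add: l2_inner_def grad_def inner_vec_def)
  also have "\<dots> = (\<Sum>i\<in>UNIV. - (\<integral>x. \<phi> x * frechet_derivative v (at x) (axis i 1) $ i \<partial>torus))"
    using c by (subst Bochner_Integration.integral_sum)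
      (auto simp: parts intro!: integrable_torus_continuous continuous_intros)
  also have "\<dots> = - (\<integral>x. (\<Sum>i\<in>UNIV. \<phi> x * frechet_derivative v (at x) (axis i 1) $ i) \<partial>torus)"
    using c by (subst Bochner_Integration.integral_sum)
      (auto simp: sum_negf intro!: integrable_torus_continuous continuous_intros)
  also have "(\<lambda>x. \<Sum>i\<in>UNIV. \<phi> x * frechet_derivative v (at x) (axis i 1) $ i) = (\<lambda>x. \<phi> x * divergence v x)"
    by (simp add: divergence_def sum_Basis_vec3 sum_distrib_left inner_axis)
  finally show ?thesis by (simp add: v)
qed

text \<open>
  Being orthogonal to a gradient is a closed condition in \<open>L\<^sup>2\<close>, and smooth divergence-free fields
  satisfy it by parts. This makes the \<open>q\<^sub>j\<close> admissible initial values for the propagator.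
\<close>

lemma local_fields_subset_L2_sigma: "local_fields B \<subseteq> L2_sigma"
proof
  fix f assume f: "f \<in> local_fields B"
  have fL2: "f \<in> L2" using f by (simp add: local_fields_def)
  have "l2_inner (grad \<phi>) f = 0" if \<phi>: "smooth_on UNIV \<phi>" "periodic \<phi>" for \<phi>
  proof -
    have G: "grad \<phi> \<in> L2" using \<phi> by (rule grad_L2)
    define K where "K = 1 + (l2_norm (grad \<phi>))\<^sup>2"
    have K: "K \<ge> 1" by (simp add: K_def)
    have "\<bar>l2_inner (grad \<phi>) f\<bar> \<le> 0 + e" if "e > 0" for e
    proof -
      define c where "c = e / K"
      have c: "c > 0" "c \<le> e" "c * (l2_norm (grad \<phi>))\<^sup>2 \<le> e"
        using K \<open>e > 0\<close> by (auto simp: c_def K_def algebra_simps pos_divide_le_eq add_pos_nonneg)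
      have "\<exists>v. smooth_on UNIV v \<and> periodic v \<and> (\<forall>x. divergence v x = 0) \<and> l2_norm (\<lambda>x. f x - v x) < c"
        using f c(1) unfolding local_fields_def by blast
      then obtain v where v: "smooth_on UNIV v" "periodic v" "\<And>x. divergence v x = 0"
        and close: "l2_norm (\<lambda>x. f x - v x) < c"
        by auto
      have vL2: "v \<in> L2"
        using v smooth_on_UNIV_D(1) by (intro L2_continuous differentiable_imp_continuous_on)
      have "l2_inner (grad \<phi>) f = l2_inner (grad \<phi>) (\<lambda>x. f x - v x)"
        using l2_inner_grad_solenoidal[OF \<phi> v] l2_inner_diff_right[OF G fL2 vL2] by simp
      moreover have "2 * \<bar>l2_inner (grad \<phi>) (\<lambda>x. f x - v x)\<bar>
          \<le> c * (l2_norm (grad \<phi>))\<^sup>2 + (l2_norm (\<lambda>x. f x - v x))\<^sup>2 / c"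
        using G fL2 vL2 c by (intro abs_l2_inner_le L2_diff)
      moreover have "(l2_norm (\<lambda>x. f x - v x))\<^sup>2 / c \<le> c"
        using close c l2_norm_nonneg[of "\<lambda>x. f x - v x"] power_mono[of "l2_norm (\<lambda>x. f x - v x)" c 2]
        by (simp add: divide_le_eq power2_eq_square)
      ultimately show ?thesis using c by linarith
    qed
    then have "\<bar>l2_inner (grad \<phi>) f\<bar> \<le> 0" by (rule field_le_epsilon)
    then show ?thesis by simp
  qed
  with fL2 show "f \<in> L2_sigma" by (simp add: L2_sigma_iff)
qed

section \<open>Smoothness of slices and partial derivatives\<close>

text \<open>
  \<^const>\<open>Ck_on\<close> iterates derivatives within \<open>S\<close>, while the differential operators use derivatives at a
  point of the whole space. On an open set the two agree, and the congruence lemmas carry smoothness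
  from one to the other.
\<close>

lemma frechet_derivative_cong_on:
  assumes "x \<in> S" "\<And>y. y \<in> S \<Longrightarrow> f y = g y"
  shows "frechet_derivative f (at x within S) = frechet_derivative g (at x within S)"
proof -
  have "(f has_derivative D) (at x within S) \<longleftrightarrow> (g has_derivative D) (at x within S)" for D
    using has_derivative_transform[of x S f g] has_derivative_transform[of x S g f] assms by metis
  then show ?thesis by (simp add: frechet_derivative_def)
qed

lemma Ck_on_cong:
  assumes "\<And>x. x \<in> S \<Longrightarrow> f x = g x"
  shows "Ck_on n S f \<longleftrightarrow> Ck_on n S g"
  using assms
proof (induction n arbitrary: f g)
  case 0
  then show ?case by (auto cong: continuous_on_cong)
next
  case (Suc n)
  have "f differentiable_on S \<longleftrightarrow> g differentiable_on S"
    using Suc.prems has_derivative_transform[of _ S f g] has_derivative_transform[of _ S g f]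
    unfolding differentiable_on_def differentiable_def by metis
  moreover have "Ck_on n S (\<lambda>x. frechet_derivative f (at x within S) v)
      \<longleftrightarrow> Ck_on n S (\<lambda>x. frechet_derivative g (at x within S) v)" for v
    using Suc.prems by (intro Suc.IH) (simp add: frechet_derivative_cong_on[of _ S f g])
  ultimately show ?case by simp
qed

lemma smooth_on_cong:
  "(\<And>x. x \<in> S \<Longrightarrow> f x = g x) \<Longrightarrow> smooth_on S f \<Longrightarrow> smooth_on S g"
  unfolding smooth_on_def using Ck_on_cong[of S f g] by blast

lemma smooth_on_frechet_derivative:
  assumes "smooth_on S f"
  shows "smooth_on S (\<lambda>x. frechet_derivative f (at x within S) v)"
  unfolding smooth_on_def
proof
  fix n
  have "Ck_on (Suc n) S f" using assms unfolding smooth_on_def by blast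
  then show "Ck_on n S (\<lambda>x. frechet_derivative f (at x within S) v)" by simp
qed

lemma smooth_on_continuous: "smooth_on S f \<Longrightarrow> continuous_on S f"
  by (metis Ck_on.simps(1) smooth_on_def)

lemma smooth_on_differentiable: "smooth_on S f \<Longrightarrow> f differentiable_on S"
  by (metis Ck_on.simps(2) smooth_on_def)

context
  fixes I :: "real set" and h :: "real \<Rightarrow> 'a::real_normed_vector \<Rightarrow> 'b::real_normed_vector"
  assumes I: "open I" and smooth: "smooth_on (I \<times> UNIV) (\<lambda>(t, x). h t x)"
begin

lemma has_derivative_joint:
  assumes "t \<in> I"
  shows "((\<lambda>(t, x). h t x) has_derivative
    frechet_derivative (\<lambda>(t, x). h t x) (at (t, x) within I \<times> UNIV)) (at (t, x))"
proof -
  have "at (t, x) within I \<times> UNIV = at (t, x)"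
    using assms I by (intro at_within_open open_Times) auto
  moreover have "(\<lambda>(t, x). h t x) differentiable (at (t, x) within I \<times> UNIV)"
    using smooth_on_differentiable[OF smooth] assms unfolding differentiable_on_def by blast
  ultimately show ?thesis
    unfolding frechet_derivative_works by simp
qed

lemma has_derivative_space_slice:
  assumes "t \<in> I"
  shows "(h t has_derivative
    (\<lambda>v. frechet_derivative (\<lambda>(t, x). h t x) (at (t, x) within I \<times> UNIV) (0, v))) (at x)"
proof -
  have "((\<lambda>y. (t, y)) has_derivative (\<lambda>v. (0, v))) (at x)"
    by (auto intro!: derivative_eq_intros)
  from has_derivative_compose[OF this has_derivative_joint[OF assms]]
  show ?thesis by simp
qed

lemma has_vector_derivative_time_slice:
  assumes "t \<in> I"
  shows "((\<lambda>r. h r x) has_vector_derivative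
    frechet_derivative (\<lambda>(t, x). h t x) (at (t, x) within I \<times> UNIV) (1, 0)) (at t)"
proof -
  let ?D = "frechet_derivative (\<lambda>(t, x). h t x) (at (t, x) within I \<times> UNIV)"
  have "((\<lambda>r. (r, x)) has_derivative (\<lambda>s. (s, 0))) (at t)"
    by (auto intro!: derivative_eq_intros)
  from has_derivative_compose[OF this has_derivative_joint[OF assms]]
  have "((\<lambda>r. h r x) has_derivative (\<lambda>s. ?D (s, 0))) (at t)" by simp
  moreover have "(\<lambda>s. ?D (s, 0)) = (\<lambda>s. s *\<^sub>R ?D (1, 0))"
  proof
    show "?D (s, 0) = s *\<^sub>R ?D (1, 0)" for s
      using linear_cmul[OF has_derivative_linear[OF has_derivative_joint[OF assms]], of x s "(1, 0)"]
      by (simp only: scaleR_Pair real_scaleR_def mult_1_right scaleR_zero_right)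
  qed
  ultimately show ?thesis
    unfolding has_vector_derivative_def by (rule has_derivative_eq_rhs)
qed

lemma smooth_on_space_derivative:
  "smooth_on (I \<times> UNIV) (\<lambda>(t, x). frechet_derivative (h t) (at x) v)"
  using frechet_derivative_at[OF has_derivative_space_slice]
  by (intro smooth_on_cong[OF _ smooth_on_frechet_derivative[OF smooth, of "(0, v)"]])
     (auto simp: fun_eq_iff)

lemma smooth_on_time_derivative:
  "smooth_on (I \<times> UNIV) (\<lambda>(t, x). vector_derivative (\<lambda>r. h r x) (at t))"
  using vector_derivative_at[OF has_vector_derivative_time_slice]
  by (intro smooth_on_cong[OF _ smooth_on_frechet_derivative[OF smooth, of "(1, 0)"]]) auto

lemma has_vector_derivative_time:
  "t \<in> I \<Longrightarrow> ((\<lambda>r. h r x) has_vector_derivative vector_derivative (\<lambda>r. h r x) (at t)) (at t)"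
  using has_vector_derivative_time_slice vector_derivative_works differentiableI_vector by blast

end

lemma smooth_on_slice:
  fixes I :: "real set"
  assumes "open I" "t \<in> I" "smooth_on (I \<times> UNIV) (\<lambda>(t, x). h t x)"
  shows "smooth_on UNIV (h t)"
proof -
  have "Ck_on n UNIV (h t)" for n
    using assms(3)
  proof (induction n arbitrary: h)
    case 0
    then show ?case
      using continuous_on_slice[OF smooth_on_continuous assms(2)] by simp
  next
    case (Suc n)
    have "h t differentiable_on UNIV"
      using has_derivative_space_slice[OF assms(1) Suc.prems assms(2)]
      by (auto simp: differentiable_on_def differentiable_def)
    moreover have "Ck_on n UNIV (\<lambda>x. frechet_derivative (h t) (at x) v)" for v
      using Suc.IH[of "\<lambda>t x. frechet_derivative (h t) (at x) v"]
        smooth_on_space_derivative[OF assms(1) Suc.prems] by simp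
    ultimately show ?case by simp
  qed
  then show ?thesis by (simp add: smooth_on_def)
qed

lemma continuous_on_laplacian:
  fixes I :: "real set"
  assumes "open I" "smooth_on (I \<times> UNIV) (\<lambda>(t, x). h t x)"
  shows "continuous_on (I \<times> UNIV) (\<lambda>(t, x). laplacian (h t) x)"
  unfolding laplacian_def split_beta
  using smooth_on_continuous[OF smooth_on_space_derivative[OF assms(1) smooth_on_space_derivative[OF assms]]]
  by (intro continuous_on_sum) (simp add: split_beta)

section \<open>The Dirichlet form and shifts\<close>

definition dirichlet :: "vfield \<Rightarrow> vfield \<Rightarrow> real" where
  "dirichlet f g = (\<Sum>i\<in>UNIV. l2_inner (\<lambda>x. frechet_derivative f (at x) (axis i 1))
                                     (\<lambda>x. frechet_derivative g (at x) (axis i 1)))"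

lemma dirichlet_commute: "dirichlet f g = dirichlet g f"
  by (simp add: dirichlet_def l2_inner_def inner_commute)

lemma dirichlet_eq_laplacian:
  assumes f: "smooth_on UNIV f" "periodic f" and g: "smooth_on UNIV g" "periodic g"
  shows "dirichlet f g = - l2_inner (laplacian f) g"
proof -
  let ?f = "\<lambda>i x. frechet_derivative f (at x) (axis i 1)"
  let ?ff = "\<lambda>i x. frechet_derivative (?f i) (at x) (axis i 1)"
  have f': "smooth_on UNIV (?f i)" for i
    using smooth_on_frechet_derivative[OF f(1)] by simp
  have "(\<integral>x. ?ff i x \<bullet> g x \<partial>torus) = - (\<integral>x. ?f i x \<bullet> frechet_derivative g (at x) (axis i 1) \<partial>torus)" for i
    by (rule integral_torus_by_parts[OF periodic_frechet_derivative[OF f(2)] g(2)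
        has_derivative_frechet[OF smooth_on_differentiable[OF f'[of i]]]
        has_derivative_frechet[OF smooth_on_differentiable[OF g(1)]]
        smooth_on_UNIV_D(2)[OF f'[of i]] smooth_on_UNIV_D(2)[OF g(1)]])
  then have "dirichlet f g = - (\<Sum>i\<in>UNIV. \<integral>x. ?ff i x \<bullet> g x \<partial>torus)"
    by (simp add: dirichlet_def l2_inner_def sum_negf)
  also have "\<dots> = - (\<integral>x. (\<Sum>i\<in>UNIV. ?ff i x \<bullet> g x) \<partial>torus)"
    using f' smooth_on_UNIV_D(2) smooth_on_continuous[OF g(1)]
    by (subst Bochner_Integration.integral_sum)
       (auto intro!: integrable_torus_continuous continuous_intros)
  also have "(\<lambda>x. \<Sum>i\<in>UNIV. ?ff i x \<bullet> g x) = (\<lambda>x. laplacian f x \<bullet> g x)"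
    by (simp add: laplacian_def sum_Basis_vec3 inner_sum_left)
  finally show ?thesis by (simp add: l2_inner_def)
qed

text \<open>
  Jensen's inequality on \<open>[0, 1]\<close>: the variance of \<open>v\<close> is non-negative.
\<close>

lemma norm_integral_sq_le:
  fixes v :: "real \<Rightarrow> 'a::euclidean_space"
  assumes "continuous_on {0..1} v"
  shows "(norm (integral {0..1} v))\<^sup>2 \<le> integral {0..1} (\<lambda>r. (norm (v r))\<^sup>2)"
proof -
  define m where "m = integral {0..1} v"
  have i: "v integrable_on {0..1}" "(\<lambda>r. v r \<bullet> m) integrable_on {0..1}"
      "(\<lambda>r. (norm (v r))\<^sup>2) integrable_on {0..1}"
    using assms by (auto intro!: integrable_continuous_interval continuous_intros)
  have vm: "integral {0..1} (\<lambda>r. v r \<bullet> m) = m \<bullet> m"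
    using integral_linear[OF i(1) bounded_linear_inner_left[of m]] by (simp add: o_def m_def)
  have "0 \<le> integral {0..1} (\<lambda>r. (norm (v r - m))\<^sup>2)"
    using assms by (intro integral_nonneg integrable_continuous_interval continuous_intros) auto
  also have "(\<lambda>r. (norm (v r - m))\<^sup>2) = (\<lambda>r. (norm (v r))\<^sup>2 - 2 * (v r \<bullet> m) + m \<bullet> m)"
    by (simp add: power2_norm_eq_inner inner_diff inner_commute algebra_simps)
  also have "integral {0..1} (\<lambda>r. (norm (v r))\<^sup>2 - 2 * (v r \<bullet> m) + m \<bullet> m)
      = integral {0..1} (\<lambda>r. (norm (v r))\<^sup>2) - m \<bullet> m"
  proof -
    have "((\<lambda>r. (norm (v r))\<^sup>2 - 2 * (v r \<bullet> m) + m \<bullet> m) has_integral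
        integral {0..1} (\<lambda>r. (norm (v r))\<^sup>2) - 2 * (m \<bullet> m) + (1 - 0) *\<^sub>R (m \<bullet> m)) {0..1}"
      using i vm
      by (intro has_integral_add has_integral_diff has_integral_mult_right has_integral_const_real
          integrable_integral) (auto simp: has_integral_iff)
    then show ?thesis by (simp add: integral_unique)
  qed
  finally show ?thesis by (simp add: m_def power2_norm_eq_inner)
qed

text \<open>
  The energy controls shifts: \<open>f (x + s e\<^sub>i) - f x\<close> is \<open>s\<close> times the mean of \<open>\<partial>\<^sub>i f\<close> along the
  segment, and after integration over the torus each point of the segment contributes the same amount
  \<open>\<parallel>\<partial>\<^sub>i f\<parallel>\<^sup>2\<close>.
\<close>

lemma integral_shift_difference_le:
  assumes f: "smooth_on UNIV f" "periodic f" and s: "0 \<le> s" "s \<le> 1"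
  shows "(\<integral>x. (norm (f (x + s *\<^sub>R axis i 1) - f x))\<^sup>2 \<partial>torus) \<le> s\<^sup>2 * dirichlet f f"
proof -
  let ?d = "\<lambda>x. frechet_derivative f (at x) (axis i 1)"
  let ?v = "\<lambda>x r. ?d (x + (r * s) *\<^sub>R axis i 1)"
  note d = smooth_on_UNIV_D(2)[OF f(1)]
  have cv: "continuous_on A (\<lambda>p. ?v (X p) (R p))"
    if "continuous_on A X" "continuous_on A R" for A :: "'c::topological_space set" and X R
    using that by (intro continuous_on_compose2[OF d]) (auto intro!: continuous_intros)
  have cf: "continuous_on UNIV f" using f(1) by (rule smooth_on_continuous)
  have pointwise: "(norm (f (x + s *\<^sub>R axis i 1) - f x))\<^sup>2 \<le> s\<^sup>2 * integral {0..1} (\<lambda>r. (norm (?v x r))\<^sup>2)" for x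
  proof -
    have "((\<lambda>r. f (x + (r * s) *\<^sub>R axis i 1)) has_vector_derivative s *\<^sub>R ?v x r) (at r within {0..1})" for r
    proof -
      have D: "(f has_derivative frechet_derivative f (at y)) (at y)" for y
        using f(1) by (intro has_derivative_frechet smooth_on_differentiable)
      have "((\<lambda>r. f (x + (r * s) *\<^sub>R axis i 1)) has_derivative
          (\<lambda>k. frechet_derivative f (at (x + (r * s) *\<^sub>R axis i 1)) ((k * s) *\<^sub>R axis i 1))) (at r within {0..1})"
        by (rule has_derivative_compose[OF _ D]) (auto intro!: derivative_eq_intros)
      then show ?thesis
        by (simp add: has_vector_derivative_def linear_cmul[OF has_derivative_linear[OF D]])
    qed
    then have "((\<lambda>r. s *\<^sub>R ?v x r) has_integral f (x + (1 * s) *\<^sub>R axis i 1) - f (x + (0 * s) *\<^sub>R axis i 1)) {0..1}"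
      by (intro fundamental_theorem_of_calculus) auto
    then have "f (x + s *\<^sub>R axis i 1) - f x = s *\<^sub>R integral {0..1} (?v x)"
      by (auto dest!: integral_unique)
    then have "(norm (f (x + s *\<^sub>R axis i 1) - f x))\<^sup>2 = s\<^sup>2 * (norm (integral {0..1} (?v x)))\<^sup>2"
      by (simp add: power_mult_distrib)
    also have "\<dots> \<le> s\<^sup>2 * integral {0..1} (\<lambda>r. (norm (?v x r))\<^sup>2)"
      by (intro mult_left_mono norm_integral_sq_le cv) (auto intro!: continuous_intros)
    finally show ?thesis .
  qed
  have ci: "continuous_on UNIV (\<lambda>x. integral {0..1} (\<lambda>r. (norm (?v x r))\<^sup>2))"
    unfolding interval_cbox
    by (rule integral_continuous_on_param) (auto simp: split_beta intro!: continuous_intros cv)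
  have "(\<integral>x. (norm (f (x + s *\<^sub>R axis i 1) - f x))\<^sup>2 \<partial>torus)
      \<le> (\<integral>x. s\<^sup>2 * integral {0..1} (\<lambda>r. (norm (?v x r))\<^sup>2) \<partial>torus)"
    by (intro integral_mono pointwise integrable_torus_continuous)
       (auto intro!: continuous_intros ci continuous_on_compose2[OF cf])
  also have "\<dots> = s\<^sup>2 * integral (cbox 0 1) (\<lambda>x. integral (cbox 0 1) (\<lambda>r. (norm (?v x r))\<^sup>2))"
    using ci[unfolded interval_cbox] unfolding interval_cbox
    by (simp add: integral_torus_continuous del: box_real)
  also have "integral (cbox 0 1) (\<lambda>x. integral (cbox 0 1) (\<lambda>r. (norm (?v x r))\<^sup>2))
      = integral (cbox 0 1) (\<lambda>r. integral (cbox 0 1) (\<lambda>x. (norm (?v x r))\<^sup>2))"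
    by (rule integral_swap_continuous) (auto simp: split_beta intro!: continuous_intros cv)
  also have "\<dots> = integral (cbox 0 1) (\<lambda>r::real. \<integral>x. (norm (?d x))\<^sup>2 \<partial>torus)"
  proof (rule Henstock_Kurzweil_Integration.integral_cong)
    fix r :: real assume "r \<in> cbox 0 1"
    then have r: "0 \<le> r * s" "r * s \<le> 1" using s by (auto intro: mult_le_one)
    have "continuous_on UNIV (\<lambda>x. (norm (?d x))\<^sup>2)" "periodic (\<lambda>x. (norm (?d x))\<^sup>2)"
      using d periodic_frechet_derivative[OF f(2)] by (auto intro!: continuous_intros simp: periodic_def)
    then have "(\<integral>x. (norm (?v x r))\<^sup>2 \<partial>torus) = (\<integral>x. (norm (?d x))\<^sup>2 \<partial>torus)"
      using r by (intro integral_torus_shift[where f = "\<lambda>x. (norm (?d x))\<^sup>2"]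
          borel_measurable_continuous_onI integrable_torus_continuous)
    moreover have "(\<integral>x. (norm (?v x r))\<^sup>2 \<partial>torus) = integral (cbox 0 1) (\<lambda>x. (norm (?v x r))\<^sup>2)"
      by (intro integral_torus_continuous continuous_intros cv)
    ultimately show "integral (cbox 0 1) (\<lambda>x. (norm (?v x r))\<^sup>2) = (\<integral>x. (norm (?d x))\<^sup>2 \<partial>torus)"
      by simp
  qed
  also have "\<dots> = l2_inner ?d ?d"
    by (simp add: l2_inner_def power2_norm_eq_inner)
  also have "\<dots> \<le> dirichlet f f"
    unfolding dirichlet_def
    by (rule member_le_sum[where f = "\<lambda>i. l2_inner (\<lambda>x. frechet_derivative f (at x) (axis i 1))
        (\<lambda>x. frechet_derivative f (at x) (axis i 1))"]) (auto simp: l2_inner_def)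
  finally show ?thesis by (simp add: mult_left_mono)
qed

section \<open>Evolution of the Dirichlet energy\<close>

lemma has_real_derivative_diagonal:
  fixes \<Phi> \<phi> :: "real \<Rightarrow> real \<Rightarrow> real"
  assumes I: "open I" "convex I" "t \<in> I"
    and sym: "\<And>s t. s \<in> I \<Longrightarrow> t \<in> I \<Longrightarrow> \<Phi> s t = \<Phi> t s"
    and deriv: "\<And>s t. s \<in> I \<Longrightarrow> t \<in> I \<Longrightarrow> ((\<lambda>s. \<Phi> s t) has_real_derivative \<phi> s t) (at s)"
    and cont: "continuous_on (I \<times> I) (\<lambda>(s, t). \<phi> s t)"
  shows "((\<lambda>t. \<Phi> t t) has_real_derivative 2 * \<phi> t t) (at t)"
proof -
  have "((\<lambda>(x, y). \<Phi> x y) has_derivative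
      (\<lambda>(tx, ty). \<phi> t t * tx + blinfun_mult_right (\<phi> t t) ty)) (at (t, t) within I \<times> I)"
  proof (rule has_derivative_partialsI[where fy = "\<lambda>x y. blinfun_mult_right (\<phi> y x)"])
    show "((\<lambda>x. \<Phi> x t) has_derivative (*) (\<phi> t t)) (at t within I)"
      using deriv[OF I(3) I(3)] has_derivative_at_withinI by (auto simp: has_field_derivative_def)
    show "((\<lambda>y. \<Phi> x y) has_derivative blinfun_apply (blinfun_mult_right (\<phi> y x))) (at y within I)"
      if "x \<in> I" "y \<in> I" for x y
    proof (rule has_derivative_transform[OF that(2)])
      show "\<Phi> x y' = \<Phi> y' x" if "y' \<in> I" for y' using sym \<open>x \<in> I\<close> that .
      show "((\<lambda>y. \<Phi> y x) has_derivative blinfun_apply (blinfun_mult_right (\<phi> y x))) (at y within I)"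
        using deriv[OF that(2,1)] has_derivative_at_withinI
        by (auto simp: has_field_derivative_def blinfun_mult_right.rep_eq)
    qed
    have "continuous_on (I \<times> I) (\<lambda>p. \<phi> (snd p) (fst p))"
      by (rule continuous_on_compose2[OF cont, of "I \<times> I" "\<lambda>p. (snd p, fst p)", unfolded prod.case])
         (auto intro!: continuous_intros)
    then have "continuous_on (I \<times> I) (\<lambda>p. blinfun_mult_right (\<phi> (snd p) (fst p)))"
      by (intro continuous_intros)
    then show "continuous (at (t, t) within I \<times> I) (\<lambda>(x, y). blinfun_mult_right (\<phi> y x))"
      using I(3) unfolding continuous_on_eq_continuous_within split_beta by blast
  qed (use I in auto)
  moreover have "at (t, t) within I \<times> I = at (t, t)"
    using I by (intro at_within_open open_Times) auto
  ultimately have joint: "((\<lambda>(x, y). \<Phi> x y) has_derivative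
      (\<lambda>(tx, ty). \<phi> t t * tx + blinfun_mult_right (\<phi> t t) ty)) (at (t, t))" by simp
  have diag: "((\<lambda>r. (r, r)) has_derivative (\<lambda>k. (k, k))) (at t)"
    by (auto intro!: derivative_eq_intros)
  have "((\<lambda>r. \<Phi> r r) has_derivative (\<lambda>k. \<phi> t t * k + \<phi> t t * k)) (at t)"
    using has_derivative_compose[OF diag joint] by (simp add: blinfun_mult_right.rep_eq)
  then show ?thesis
    unfolding has_field_derivative_def by (rule has_derivative_eq_rhs) (auto simp: algebra_simps)
qed

context
  fixes I :: "real set" and h :: "real \<Rightarrow> vfield"
  assumes I: "open I" "convex I" and smooth: "smooth_on (I \<times> UNIV) (\<lambda>(t, x). h t x)"
    and per: "\<And>t. t \<in> I \<Longrightarrow> periodic (h t)"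
begin

lemma continuous_on_laplacian_time_derivative:
  "continuous_on (I \<times> I) (\<lambda>(s, t). l2_inner (laplacian (h t)) (\<lambda>x. vector_derivative (\<lambda>r. h r x) (at s)))"
proof -
  note L = continuous_on_laplacian[OF I(1) smooth, unfolded split_beta]
  note D = smooth_on_continuous[OF smooth_on_time_derivative[OF I(1) smooth], unfolded split_beta]
  have "continuous_on ((I \<times> I) \<times> UNIV)
      (\<lambda>(p, x). laplacian (h (snd p)) x \<bullet> vector_derivative (\<lambda>r. h r x) (at (fst p)))"
    unfolding split_beta
    by (intro continuous_on_inner
        continuous_on_compose2[OF L, of _ "\<lambda>p. (snd (fst p), snd p)", unfolded fst_conv snd_conv]
        continuous_on_compose2[OF D, of _ "\<lambda>p. (fst (fst p), snd p)", unfolded fst_conv snd_conv])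
       (auto intro!: continuous_intros)
  then show ?thesis
    unfolding l2_inner_def split_beta by (intro continuous_on_integral_torus) (simp add: split_beta)
qed

text \<open>
  Writing the form as \<open>- \<langle>\<Delta>h(t), h(s)\<rangle>\<close> with \<open>t\<close> fixed puts every space derivative on the factor
  that does not move. Differentiating in \<open>s\<close> therefore needs only \<open>\<partial>\<^sub>t h\<close>, and no exchange of mixed
  time and space derivatives; the energy is recovered on the diagonal \<open>s = t\<close> by symmetry.
\<close>

lemma dirichlet_has_derivative_left:
  assumes "s \<in> I" "t \<in> I"
  shows "((\<lambda>s. dirichlet (h s) (h t)) has_real_derivative
    - l2_inner (laplacian (h t)) (\<lambda>x. vector_derivative (\<lambda>r. h r x) (at s))) (at s)"
proof -
  note slice = smooth_on_slice[OF I(1) _ smooth]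
  have cL: "continuous_on UNIV (laplacian (h t))"
    using continuous_on_laplacian[OF I(1) smooth] assms(2) by (rule continuous_on_slice)
  have "((\<lambda>s. \<integral>x. laplacian (h t) x \<bullet> h s x \<partial>torus) has_vector_derivative
      (\<integral>x. laplacian (h t) x \<bullet> vector_derivative (\<lambda>r. h r x) (at s) \<partial>torus)) (at s within I)"
  proof (rule has_vector_derivative_integral_torus[OF _ _ _ assms(1) I(2)])
    show "((\<lambda>s. laplacian (h t) x \<bullet> h s x) has_vector_derivative
        laplacian (h t) x \<bullet> vector_derivative (\<lambda>r. h r x) (at r)) (at r within I)" if "r \<in> I" for r x
      by (rule bounded_linear.has_vector_derivative[OF bounded_linear_inner_right])
         (rule has_vector_derivative_at_within[OF has_vector_derivative_time[OF I(1) smooth that]])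
    show "continuous_on UNIV (\<lambda>x. laplacian (h t) x \<bullet> h r x)" if "r \<in> I" for r
      using cL smooth_on_continuous[OF slice[OF that]] by (intro continuous_intros)
    show "continuous_on (I \<times> UNIV) (\<lambda>(s, x). laplacian (h t) x \<bullet> vector_derivative (\<lambda>r. h r x) (at s))"
      using smooth_on_continuous[OF smooth_on_time_derivative[OF I(1) smooth]]
      unfolding split_beta by (intro continuous_on_inner continuous_on_compose2[OF cL] continuous_intros) auto
  qed
  then have "((\<lambda>s. - l2_inner (laplacian (h t)) (h s)) has_vector_derivative
      - l2_inner (laplacian (h t)) (\<lambda>x. vector_derivative (\<lambda>r. h r x) (at s))) (at s within I)"
    unfolding l2_inner_def by (rule has_vector_derivative_minus)
  then have "((\<lambda>s. dirichlet (h s) (h t)) has_vector_derivative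
      - l2_inner (laplacian (h t)) (\<lambda>x. vector_derivative (\<lambda>r. h r x) (at s))) (at s within I)"
  proof (rule has_vector_derivative_transform[OF assms(1), rotated])
    show "dirichlet (h r) (h t) = - l2_inner (laplacian (h t)) (h r)" if "r \<in> I" for r
      unfolding dirichlet_commute[of "h r"]
      by (rule dirichlet_eq_laplacian[OF slice[OF assms(2)] per[OF assms(2)] slice[OF that] per[OF that]])
  qed
  then show ?thesis
    unfolding has_real_derivative_iff_has_vector_derivative at_within_open[OF assms(1) I(1)] .
qed

lemma dirichlet_energy_has_derivative:
  assumes "t \<in> I"
  shows "((\<lambda>t. dirichlet (h t) (h t)) has_real_derivative
    - 2 * l2_inner (laplacian (h t)) (\<lambda>x. vector_derivative (\<lambda>r. h r x) (at t))) (at t)"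
proof -
  let ?\<Phi> = "\<lambda>s t. dirichlet (h s) (h t)"
  let ?\<phi> = "\<lambda>s t. - l2_inner (laplacian (h t)) (\<lambda>x. vector_derivative (\<lambda>r. h r x) (at s))"
  have "((\<lambda>t. ?\<Phi> t t) has_real_derivative 2 * ?\<phi> t t) (at t)"
  proof (rule has_real_derivative_diagonal[where \<Phi> = ?\<Phi> and \<phi> = ?\<phi>, OF I assms])
    show "?\<Phi> s t = ?\<Phi> t s" for s t by (rule dirichlet_commute)
    show "((\<lambda>s. ?\<Phi> s t) has_real_derivative ?\<phi> s t) (at s)" if "s \<in> I" "t \<in> I" for s t
      using that by (rule dirichlet_has_derivative_left)
    show "continuous_on (I \<times> I) (\<lambda>(s, t). ?\<phi> s t)"
      using continuous_on_minus[OF continuous_on_laplacian_time_derivative] unfolding split_beta .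
  qed
  moreover have "2 * ?\<phi> t t = - 2 * l2_inner (laplacian (h t)) (\<lambda>x. vector_derivative (\<lambda>r. h r x) (at t))"
    by linarith
  ultimately show ?thesis by (rule DERIV_cong)
qed

text \<open>
  Pairing the equation with \<open>\<Delta>h\<close> gives \<open>\<langle>\<Delta>h, P[(u \<cdot> \<nabla>)h]\<rangle> = \<nu> \<parallel>\<Delta>h\<parallel>\<^sup>2 - \<langle>\<Delta>h, \<partial>\<^sub>t h\<rangle>\<close>: dissipation
  only lowers the energy, so production is at least half of its rate of growth.
\<close>

lemma time_derivative_le_production:
  assumes "\<nu> \<ge> 0" "transport_eq \<nu> u I h" "t \<in> I"
  shows "- l2_inner (laplacian (h t)) (\<lambda>x. vector_derivative (\<lambda>r. h r x) (at t))
    \<le> l2_inner (laplacian (h t)) (leray (advect (u t) (h t)))"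
proof -
  let ?L = "laplacian (h t)" and ?D = "\<lambda>x. vector_derivative (\<lambda>r. h r x) (at t)"
  obtain w where w: "is_leray (advect (u t) (h t)) w"
    and eq: "\<And>x. ?D x + w x = \<nu> *\<^sub>R ?L x"
    using bspec[OF assms(2)[unfolded transport_eq_def] assms(3)]
    unfolding at_within_open[OF assms(3) I(1)] by blast
  have cL: "continuous_on UNIV ?L"
    using continuous_on_laplacian[OF I(1) smooth] assms(3) by (rule continuous_on_slice)
  have cD: "continuous_on UNIV ?D"
    using smooth_on_continuous[OF smooth_on_time_derivative[OF I(1) smooth]] assms(3)
    by (rule continuous_on_slice)
  have "periodic ?L"
    using periodic_frechet_derivative[OF periodic_frechet_derivative[OF per[OF assms(3)]]]
    unfolding laplacian_def periodic_def by simp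
  then have L: "?L \<in> L2" using cL by (intro L2_continuous)
  have "l2_inner ?L (leray (advect (u t) (h t))) = l2_inner ?L w"
    using w L by (rule l2_inner_leray)
  also have "\<dots> = (\<integral>x. \<nu> * (?L x \<bullet> ?L x) - ?L x \<bullet> ?D x \<partial>torus)"
  proof -
    have "w x = \<nu> *\<^sub>R ?L x - ?D x" for x using eq[of x] by (simp add: algebra_simps)
    then show ?thesis by (simp add: l2_inner_def inner_diff_right)
  qed
  also have "\<dots> = \<nu> * l2_inner ?L ?L - l2_inner ?L ?D"
    unfolding l2_inner_def using cL cD
    by (subst Bochner_Integration.integral_diff) (auto intro!: integrable_torus_continuous continuous_intros)
  finally show ?thesis
    using \<open>\<nu> \<ge> 0\<close> by (simp add: l2_inner_def)
qed

end

text \<open>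
  The non-negative integral is a supremum over simple functions below the integrand, hence monotone
  for arbitrary \<open>p\<close>. This lets a continuous minorant \<open>f\<close> bound the integral of the production from
  below.
\<close>

lemma increment_le_nn_integral:
  fixes F f p :: "real \<Rightarrow> real"
  assumes "a \<le> b" and F: "\<And>t. t \<in> {a..b} \<Longrightarrow> (F has_real_derivative f t) (at t)"
    and f: "continuous_on {a..b} f" and p: "\<And>t. t \<in> {a<..<b} \<Longrightarrow> f t \<le> p t"
  shows "ennreal (F b - F a) \<le> (\<integral>\<^sup>+t\<in>{a<..<b}. ennreal (max (p t) 0) \<partial>lborel)"
proof -
  have "(f has_integral F b - F a) {a..b}"
    using F \<open>a \<le> b\<close>
    by (intro fundamental_theorem_of_calculus)
       (auto simp flip: has_real_derivative_iff_has_vector_derivative intro: has_field_derivative_at_within)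
  moreover have int: "((\<lambda>t. max (f t) 0) has_integral integral {a..b} (\<lambda>t. max (f t) 0)) {a..b}"
    using f by (intro integrable_integral integrable_continuous_interval continuous_intros)
  ultimately have "F b - F a \<le> integral {a..b} (\<lambda>t. max (f t) 0)"
    by (rule has_integral_le) simp
  then have "ennreal (F b - F a) \<le> ennreal (integral {a..b} (\<lambda>t. max (f t) 0))"
    by (rule ennreal_leI)
  also have "\<dots> = (\<integral>\<^sup>+t\<in>{a<..<b}. ennreal (max (f t) 0) \<partial>lborel)"
    using int unfolding has_integral_Icc_iff_Ioo
    by (intro nn_integral_has_integral_lebesgue'[symmetric]) auto
  also have "\<dots> \<le> (\<integral>\<^sup>+t\<in>{a<..<b}. ennreal (max (p t) 0) \<partial>lborel)"
    using p by (intro nn_integral_mono) (auto simp: indicator_def intro!: ennreal_leI max.coboundedI1)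
  finally show ?thesis .
qed

section \<open>Concentration\<close>

lemma L2_shift:
  assumes "f \<in> L2" "0 \<le> s" "s \<le> 1"
  shows "(\<lambda>x. f (x + s *\<^sub>R axis i 1)) \<in> L2"
    "(\<integral>x. (norm (f (x + s *\<^sub>R axis i 1)))\<^sup>2 \<partial>torus) = (l2_norm f)\<^sup>2"
proof -
  have m: "(\<lambda>x. (norm (f x))\<^sup>2) \<in> borel_measurable borel" "periodic (\<lambda>x. (norm (f x))\<^sup>2)"
    using L2_D[OF assms(1)] by (auto simp: periodic_def)
  show "(\<integral>x. (norm (f (x + s *\<^sub>R axis i 1)))\<^sup>2 \<partial>torus) = (l2_norm f)\<^sup>2"
    unfolding l2_norm_sq using m L2_D(3)[OF assms(1)] assms(2,3) by (rule integral_torus_shift)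
  have "integrable torus (\<lambda>x. (norm (f (x + s *\<^sub>R axis i 1)))\<^sup>2)"
    using m L2_D(3)[OF assms(1)] assms(2,3) by (rule integrable_torus_shift)
  moreover have "(\<lambda>x. f (x + s *\<^sub>R axis i 1)) \<in> borel_measurable borel"
    by (rule measurable_compose[OF _ L2_D(1)[OF assms(1)]]) simp
  moreover have "periodic (\<lambda>x. f (x + s *\<^sub>R axis i 1))"
    unfolding periodic_def
  proof (intro allI ballI)
    fix x z assume "z \<in> lattice"
    then have "f ((x + s *\<^sub>R axis i 1) + z) = f (x + s *\<^sub>R axis i 1)"
      using L2_D(2)[OF assms(1)] unfolding periodic_def by blast
    then show "f (x + z + s *\<^sub>R axis i 1) = f (x + s *\<^sub>R axis i 1)"
      by (simp only: ac_simps)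
  qed
  ultimately show "(\<lambda>x. f (x + s *\<^sub>R axis i 1)) \<in> L2" by (simp add: L2_def)
qed

lemma AE_lborel_shift:
  fixes c :: "'a::euclidean_space"
  assumes "AE x in lborel. P x"
  shows "AE x in lborel. P (x + c)"
proof -
  have "AE x in distr lborel borel ((+) c). P x"
    unfolding lborel_distr_plus by (rule assms)
  then have "AE x in lborel. P (c + x)" by (rule AE_distrD[rotated]) simp
  then show ?thesis by (simp add: add.commute)
qed

lemma norm_diff_sq_le:
  fixes a b :: "'a::real_inner"
  shows "(norm (a - b))\<^sup>2 \<le> 2 * (norm a)\<^sup>2 + 2 * (norm b)\<^sup>2"
  using inner_ge_zero[of "a + b"]
  by (simp add: power2_norm_eq_inner inner_add inner_diff inner_commute algebra_simps)

text \<open>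
  Since \<open>q\<close> and its shift live on disjoint sets, they are orthogonal and their difference has squared
  norm \<open>2\<close>. Replacing \<open>q\<close> by \<open>H\<close> costs a factor \<open>2\<close> and an error \<open>8 \<parallel>H - q\<parallel>\<^sup>2 \<le> 1/2\<close>, which leaves
  \<open>(2 - 1/2) / 2 = 3/4\<close>.
\<close>

lemma shift_difference_ge_of_concentrated:
  assumes q: "q \<in> L2" "l2_norm q = 1" "AE x in lborel. x \<notin> B \<longrightarrow> q x = 0"
    and B: "\<And>x. x \<in> B \<Longrightarrow> x + s *\<^sub>R axis i 1 \<notin> B" and s: "0 \<le> s" "s \<le> 1"
    and H: "H \<in> L2" "l2_norm (\<lambda>x. H x - q x) \<le> 1/4"
  shows "3/4 \<le> (\<integral>x. (norm (H (x + s *\<^sub>R axis i 1) - H x))\<^sup>2 \<partial>torus)"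
proof -
  let ?z = "s *\<^sub>R axis i 1 :: real^3" and ?e = "\<lambda>x. H x - q x"
  have e: "?e \<in> L2" using H q by (intro L2_diff)
  have dH: "integrable torus (\<lambda>x. (norm (H (x + ?z) - H x))\<^sup>2)"
    using H(1) s by (intro L2_D(3) L2_diff L2_shift)
  note int = L2_D(3)[OF L2_shift(1)[OF q(1) s, of i]] L2_D(3)[OF q(1)] dH
    L2_D(3)[OF L2_shift(1)[OF e s, of i]] L2_D(3)[OF e]
  have "AE x in lborel. q x \<bullet> q (x + ?z) = 0"
    using q(3) AE_lborel_shift[OF q(3), of ?z] by eventually_elim (use B in force)
  then have AE: "AE x in torus. q x \<bullet> q (x + ?z) = 0" by (rule AE_lborel_imp_torus)
  have "2 = (\<integral>x. (norm (q (x + ?z)))\<^sup>2 + (norm (q x))\<^sup>2 \<partial>torus)"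
    using int L2_shift(2)[OF q(1) s, of i] q(2) by (simp flip: l2_norm_sq)
  also have "\<dots> \<le> (\<integral>x. 2 * (norm (H (x + ?z) - H x))\<^sup>2
      + (4 * (norm (?e (x + ?z)))\<^sup>2 + 4 * (norm (?e x))\<^sup>2) \<partial>torus)"
  proof (rule integral_mono_AE)
    show "AE x in torus. (norm (q (x + ?z)))\<^sup>2 + (norm (q x))\<^sup>2
        \<le> 2 * (norm (H (x + ?z) - H x))\<^sup>2 + (4 * (norm (?e (x + ?z)))\<^sup>2 + 4 * (norm (?e x))\<^sup>2)"
      using AE
    proof eventually_elim
      case (elim x)
      have "(norm (q (x + ?z)))\<^sup>2 + (norm (q x))\<^sup>2 = (norm (q (x + ?z) - q x))\<^sup>2"
        using elim by (simp add: power2_norm_eq_inner inner_diff inner_commute)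
      also have "q (x + ?z) - q x = (H (x + ?z) - H x) - (?e (x + ?z) - ?e x)" by simp
      also have "(norm \<dots>)\<^sup>2 \<le> 2 * (norm (H (x + ?z) - H x))\<^sup>2 + 2 * (norm (?e (x + ?z) - ?e x))\<^sup>2"
        by (rule norm_diff_sq_le)
      finally show ?case using norm_diff_sq_le[of "?e (x + ?z)" "?e x"] by linarith
    qed
  qed (use int in \<open>auto intro!: Bochner_Integration.integrable_add\<close>)
  also have "\<dots> = 2 * (\<integral>x. (norm (H (x + ?z) - H x))\<^sup>2 \<partial>torus) + 8 * (l2_norm ?e)\<^sup>2"
    using int L2_shift(2)[OF e s, of i] by (simp add: l2_norm_sq)
  also have "(l2_norm ?e)\<^sup>2 \<le> (1/4)\<^sup>2"
    using H(2) l2_norm_nonneg by (intro power_mono)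
  finally show ?thesis by (simp add: power2_eq_square)
qed

lemma bdd_above_torus_dist:
  fixes A :: "((real^3) \<times> (real^3)) set"
  shows "bdd_above ((\<lambda>p. torus_dist (fst p) (snd p)) ` A)"
proof (rule bdd_aboveI2)
  fix p :: "(real^3) \<times> (real^3)"
  define y where "y = fst p - snd p"
  have "infdist y lattice \<le> dist y (\<chi> i. of_int \<lfloor>y $ i\<rfloor>)"
    by (rule infdist_le) (auto simp: lattice_def)
  also have "\<dots> \<le> (\<Sum>i\<in>UNIV. \<bar>(y - (\<chi> i. of_int \<lfloor>y $ i\<rfloor>)) $ i\<bar>)"
    unfolding dist_norm by (rule norm_le_l1_cart)
  also have "\<dots> \<le> (\<Sum>i\<in>(UNIV :: 3 set). 1)"
    by (intro sum_mono) (simp, linarith)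
  finally show "torus_dist (fst p) (snd p) \<le> 3" by (simp add: torus_dist_def y_def)
qed

text \<open>
  For \<open>0 \<le> s \<le> 1/2\<close> the shortest way back to the lattice from \<open>s e\<^sub>i\<close> is to the origin, so a point and
  its shift are at torus distance at least \<open>s\<close>.
\<close>

lemma shift_leaves_small_set:
  assumes "torus_diam B < s" "s \<le> 1/2" "x \<in> B"
  shows "x + s *\<^sub>R axis i 1 \<notin> B"
proof
  assume "x + s *\<^sub>R axis i 1 \<in> B"
  then have "torus_dist (x + s *\<^sub>R axis i 1) x \<le> torus_diam B"
    unfolding torus_diam_def
    using assms(3) by (intro cSUP_upper2[OF bdd_above_torus_dist, of "(x + s *\<^sub>R axis i 1, x)"]) auto
  moreover have "s \<le> torus_dist (x + s *\<^sub>R axis i 1) x"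
  proof -
    have "s \<le> dist (s *\<^sub>R axis i 1 :: real^3) z" if "z \<in> lattice" for z
    proof -
      have "z $ i \<in> \<int>" using that by (simp add: lattice_def)
      then obtain n where n: "z $ i = of_int n" by (rule Ints_cases)
      have "s \<le> \<bar>s - of_int n\<bar>"
        using assms(2) by (cases "n \<le> 0") auto
      also have "\<dots> = \<bar>(s *\<^sub>R axis i 1 - z) $ i\<bar>" by (simp add: n)
      also have "\<dots> \<le> dist (s *\<^sub>R axis i 1 :: real^3) z"
        unfolding dist_norm by (rule component_le_norm_cart)
      finally show ?thesis .
    qed
    moreover have "lattice \<noteq> {}" by (auto simp: lattice_def intro: exI[of _ 0])
    ultimately show ?thesis
      by (simp add: torus_dist_def infdist_notempty cINF_greatest)
  qed
  ultimately show False using assms(1) by simp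
qed

section \<open>Infinite production\<close>

lemma tail_vanishing_eventually:
  assumes "tail_vanishing (\<lambda>j k. ennreal (a j k))" "e > 0"
  shows "\<exists>N. \<forall>j k. N \<le> j \<longrightarrow> j < k \<longrightarrow> a j k < e"
proof -
  have "eventually (\<lambda>J. (SUP (j, k)\<in>{(j, k). J \<le> j \<and> j < k}. ennreal (a j k)) < ennreal e) sequentially"
    using assms unfolding tail_vanishing_def by (intro order_tendstoD) auto
  then obtain N where N: "(SUP (j, k)\<in>{(j, k). N \<le> j \<and> j < k}. ennreal (a j k)) < ennreal e"
    by (auto simp: eventually_sequentially)
  have "a j k < e" if "N \<le> j" "j < k" for j k
  proof -
    have "ennreal (a j k) \<le> (SUP (j, k)\<in>{(j, k). N \<le> j \<and> j < k}. ennreal (a j k))"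
      using that by (intro SUP_upper2[of "(j, k)"]) auto
    with N have "ennreal (a j k) < ennreal e" by (rule order.strict_trans1[rotated])
    then show ?thesis using ennreal_leI[of e "a j k"] by (meson not_less)
  qed
  then show ?thesis by blast
qed

text \<open>
  \<open>J\<^sub>0\<close> is chosen so that every later \<open>U(\<tau>\<^sub>k, \<tau>\<^sub>J) q\<^sub>J\<close> is within \<open>1/4\<close> of \<open>q\<^sub>k\<close>. The start of the integral
  at \<open>\<tau> (Suc J)\<close> rather than \<open>\<tau> J\<close> keeps the energy finite there: \<open>H\<close> is smooth only after \<open>\<tau> J\<close>.
\<close>

theorem corollary7p2:
  fixes \<nu> tb T :: real
    and u :: "real \<Rightarrow> vfield"
    and U :: "real \<Rightarrow> real \<Rightarrow> vfield \<Rightarrow> vfield"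
    and \<tau> :: "nat \<Rightarrow> real"
    and B :: "nat \<Rightarrow> (real^3) set"
    and q :: "nat \<Rightarrow> vfield"
  assumes "\<nu> > 0" and "tb < T"
    and "navier_stokes_flow \<nu> tb T u"
    and "propagator \<nu> tb T u U"
    and "saturated_hodge_family \<nu> tb T U \<tau> B q"
  shows "\<exists>J0. \<forall>J\<ge>J0.
    (\<integral>\<^sup>+t\<in>{\<tau> (Suc J)<..<T}. ennreal (max (production u U \<tau> q J t) 0) \<partial>lborel) = \<infinity>"
proof -
  have \<tau>: "strict_mono \<tau>" "\<And>j. \<tau> j \<in> {tb..<T}"
    and diam: "(\<lambda>j. torus_diam (B j)) \<longlonglongrightarrow> 0"
    and q: "\<And>j. l2_inner (q j) (q j) = 1" "\<And>j. q j \<in> local_fields (B j)"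
    and supp: "\<And>j. AE x in lborel. x \<notin> B j \<longrightarrow> q j x = 0"
    and tail: "tail_vanishing (\<lambda>j k. ennreal (l2_norm (\<lambda>x. U (\<tau> k) (\<tau> j) (q j) x - q k x)))"
    using assms(5) unfolding saturated_hodge_family_def by simp_all
  have qL2: "q j \<in> L2_sigma" "q j \<in> L2" for j
    using q(2)[of j] local_fields_subset_L2_sigma[of "B j"] by (auto simp: local_fields_def)
  obtain J0 where J0: "\<And>j k. J0 \<le> j \<Longrightarrow> j < k \<Longrightarrow> l2_norm (\<lambda>x. U (\<tau> k) (\<tau> j) (q j) x - q k x) < 1/4"
    using tail_vanishing_eventually[OF tail, of "1/4"] by auto
  have "(\<integral>\<^sup>+t\<in>{\<tau> (Suc J)<..<T}. ennreal (max (production u U \<tau> q J t) 0) \<partial>lborel) = \<infinity>" (is "?P = _")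
    if "J \<ge> J0" for J
  proof (rule ccontr)
    assume "?P \<noteq> \<infinity>"
    then obtain c where c: "c \<ge> 0" "?P = ennreal c" by (cases ?P) auto
    define H where "H t = U t (\<tau> J) (q J)" for t
    define I where "I = {\<tau> J<..<T}"
    have sol: "cauchy_solution \<nu> u (\<tau> J) T (q J) H"
      using assms(4) \<tau>(2) qL2 unfolding propagator_def H_def by blast
    have I: "open I" "convex I" by (simp_all add: I_def)
    have HL2: "H t \<in> L2" if "t \<in> I" for t
      using sol that unfolding cauchy_solution_def L2_sigma_def I_def by force
    then have per: "periodic (H t)" if "t \<in> I" for t using that L2_D(2) by blast
    have smooth: "smooth_on (I \<times> UNIV) (\<lambda>(t, x). H t x)" and eq: "transport_eq \<nu> u I H"
      using sol unfolding cauchy_solution_def I_def by auto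
    have \<tau>I: "\<tau> k \<in> I" if "J < k" for k
      using strict_monoD[OF \<tau>(1) that] \<tau>(2)[of k] by (simp add: I_def)
    let ?E = "\<lambda>t. dirichlet (H t) (H t)"
    let ?f = "\<lambda>t. - l2_inner (laplacian (H t)) (\<lambda>x. vector_derivative (\<lambda>r. H r x) (at t))"
    have bound: "?E (\<tau> k) \<le> ?E (\<tau> (Suc J)) + 2 * c" if k: "Suc J < k" for k
    proof -
      have le: "\<tau> (Suc J) \<le> \<tau> k" using strict_monoD[OF \<tau>(1) k] by simp
      have sub: "{\<tau> (Suc J)..\<tau> k} \<subseteq> I"
        using \<tau>I[of "Suc J"] \<tau>I[of k] k by (auto simp: I_def)
      have "ennreal (?E (\<tau> k) / 2 - ?E (\<tau> (Suc J)) / 2)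
          \<le> (\<integral>\<^sup>+t\<in>{\<tau> (Suc J)<..<\<tau> k}. ennreal (max (production u U \<tau> q J t) 0) \<partial>lborel)"
      proof (rule increment_le_nn_integral[OF le, where f = ?f])
        show "((\<lambda>t. ?E t / 2) has_real_derivative ?f t) (at t)" if "t \<in> {\<tau> (Suc J)..\<tau> k}" for t
          using DERIV_cdivide[OF dirichlet_energy_has_derivative[OF I smooth per, of t], of 2] that sub
          by auto
        show "continuous_on {\<tau> (Suc J)..\<tau> k} ?f"
          using sub
          by (intro continuous_on_minus continuous_on_compose2[OF
                continuous_on_laplacian_time_derivative[OF I smooth per], of _ "\<lambda>t. (t, t)",
                unfolded prod.case])
             (auto intro!: continuous_intros)
        show "?f t \<le> production u U \<tau> q J t" if "t \<in> {\<tau> (Suc J)<..<\<tau> k}" for t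
        proof -
          have "t \<in> I" using that sub by (auto simp: less_imp_le)
          with assms(1) show ?thesis
            unfolding production_def Let_def H_def[symmetric]
            by (intro time_derivative_le_production[OF I smooth per _ eq]) auto
        qed
      qed
      also have "\<dots> \<le> ennreal c"
        unfolding c(2)[symmetric] using \<tau>(2)[of k]
        by (intro nn_integral_mono) (auto simp: indicator_def)
      finally show ?thesis using c(1) by simp
    qed
    \<comment> \<open>\<open>M\<close> bounds the energy at all later times \<open>\<tau>\<^sub>k\<close>; the shift length makes \<open>s\<^sup>2 M\<close> smaller than \<open>3/4\<close>.\<close>
    define M where "M = max 1 (?E (\<tau> (Suc J)) + 2 * c)"
    define s where "s = 1 / (2 * M)"
    have M: "M \<ge> 1" by (simp add: M_def)
    have s: "0 < s" "s \<le> 1/2" "s\<^sup>2 * M \<le> 1/4"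
      using M by (auto simp: s_def field_simps power2_eq_square)
    have "eventually (\<lambda>k. torus_diam (B k) < s \<and> Suc J < k) sequentially"
      using order_tendstoD(2)[OF diam s(1)] eventually_gt_at_top by (rule eventually_conj)
    then obtain k where k: "torus_diam (B k) < s" "Suc J < k"
      using eventually_happens'[OF sequentially_bot] by blast
    have kI: "\<tau> k \<in> I" using \<tau>I k(2) by simp
    have "3/4 \<le> (\<integral>x. (norm (H (\<tau> k) (x + s *\<^sub>R axis 1 1) - H (\<tau> k) x))\<^sup>2 \<partial>torus)"
    proof (rule shift_difference_ge_of_concentrated[OF qL2(2) _ supp])
      show "l2_norm (q k) = 1" using q(1) by (simp add: l2_norm_def)
      show "x + s *\<^sub>R axis 1 1 \<notin> B k" if "x \<in> B k" for x
        using k(1) s(2) that by (rule shift_leaves_small_set)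
      show "l2_norm (\<lambda>x. H (\<tau> k) x - q k x) \<le> 1/4"
        using J0[OF \<open>J \<ge> J0\<close>, of k] k(2) by (simp add: H_def)
    qed (use s HL2 kI in auto)
    also have "\<dots> \<le> s\<^sup>2 * ?E (\<tau> k)"
      using smooth_on_slice[OF I(1) kI smooth] per[OF kI] s by (intro integral_shift_difference_le) auto
    also have "\<dots> \<le> s\<^sup>2 * M"
      using bound[OF k(2)] by (intro mult_left_mono) (auto simp: M_def)
    finally show False using s(3) by simp
  qed
  then show ?thesis by blast
qed

end
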